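(* Let $P(z)=a_0(z-\alpha_1)(z-\alpha_2)\cdots(z-\alpha_n)$ be a complex polynomial of degree $n$ (so $a_0\neq 0$), where $\alpha_i\neq\alpha_j$ for $1\le i,j\le n$ with $i\ne j$, and let $S=\{\alpha_1,\alpha_2,\ldots,\alpha_n\}$ be the set of all distinct zeros of $P$. Let $k$ be the number of distinct zeros of the derivative $P'(z)$. If $n\ge 2k+7$ (resp. $n\ge 2k+3$), then the following two statements are equivalent: (a) $S$ is a $URSM_2$ (resp. $URSE_2$). (b) $S$ is a $URSM$ (resp. $URSE$).
   Context: Meromorphic (resp. entire) functions are meromorphic (resp. holomorphic) in the whole complex plane $\mathbb{C}$. For $S\subset\mathbb{C}\cup\{\infty\}$ and $f$ non-constant meromorphic, $E_f(S)=\bigcup_{a\in S}\{z: f(z)-a=0\}$, regarded as a multiset in which an $a$-point of $f$ ($a\in S$) of multiplicity $m$ is counted $m$ times. For $l$ a non-negative integer or $\infty$, $E_l(a;f)$ is the multiset of all $a$-points of $f$, where an $a$-point of multiplicity $m$ is counted $m$ times if $m\le l$ and $l+1$ times if $m>l$. Set $E_f(S,l)=\bigcup_{a\in S}E_l(a;f)$ (as multisets). $S$ is a $URSM$ (resp. $URSE$), i.e. a unique range set for meromorphic (resp. entire) functions, if for any two non-constant meromorphic (resp. entire) functions $f,g$, $E_f(S)=E_g(S)$ implies $f\equiv g$. $S$ is a $URSM_l$ (resp. $URSE_l$) if for any two non-constant meromorphic (resp. entire) functions $f,g$, $E_f(S,l)=E_g(S,l)$ implies $f\equiv g$. The statement with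 "resp." is two statements: one for meromorphic functions with $n\ge 2k+7$, and one for entire functions with $n\ge 2k+3$. *)

theory Defs
  imports "HOL-Complex_Analysis.Complex_Analysis" "HOL-Library.Extended_Nat"
begin

text \<open>
  A meromorphic function on the plane is represented by its normalised version in the sense of
  \<^const>\<open>nicely_meromorphic_on\<close>: removable singularities are removed, and the (irrelevant) value at
  a pole is 0. With this convention, identity of meromorphic functions is equality in HOL.
\<close>

definition nonconst_meromorphic :: "(complex \<Rightarrow> complex) \<Rightarrow> bool" where
  "nonconst_meromorphic f \<longleftrightarrow> f nicely_meromorphic_on UNIV \<and> \<not> f constant_on UNIV"

definition nonconst_entire :: "(complex \<Rightarrow> complex) \<Rightarrow> bool" where
  "nonconst_entire f \<longleftrightarrow> f holomorphic_on UNIV \<and> \<not> f constant_on UNIV"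

text \<open>
  Multiplicity of \<open>z\<close> as an \<open>a\<close>-point of a non-constant \<open>f\<close>, 0 if it is none. The condition on
  poles is needed because the conventional value 0 at a pole does not make it a 0-point.
\<close>

definition point_mult :: "(complex \<Rightarrow> complex) \<Rightarrow> complex \<Rightarrow> complex \<Rightarrow> nat" where
  "point_mult f a z =
     (if \<not> is_pole f z \<and> f z = a then nat (zorder (\<lambda>w. f w - a) z) else 0)"

text \<open>
  The multisets may be infinite, so they are given by their multiplicity functions
  \<^typ>\<open>complex \<Rightarrow> nat\<close>. A union over \<open>a \<in> S\<close> becomes a pointwise sum; since \<open>z\<close> is an \<open>a\<close>-point for
  at most one \<open>a\<close>, the sum has at most one non-zero term, and the infinite sum is the right one
  even if \<open>S\<close> is infinite.
\<close>

definition E_set :: "(complex \<Rightarrow> complex) \<Rightarrow> complex set \<Rightarrow> complex \<Rightarrow> nat" where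
  "E_set f S = (\<lambda>z. \<Sum>\<^sub>\<infinity>a\<in>S. point_mult f a z)"

definition E_trunc_point :: "enat \<Rightarrow> complex \<Rightarrow> (complex \<Rightarrow> complex) \<Rightarrow> complex \<Rightarrow> nat" where
  "E_trunc_point l a f = (\<lambda>z. let m = point_mult f a z in
     (case l of enat l' \<Rightarrow> if m \<le> l' then m else l' + 1 | \<infinity> \<Rightarrow> m))"

definition E_trunc :: "(complex \<Rightarrow> complex) \<Rightarrow> complex set \<Rightarrow> enat \<Rightarrow> complex \<Rightarrow> nat" where
  "E_trunc f S l = (\<lambda>z. \<Sum>\<^sub>\<infinity>a\<in>S. E_trunc_point l a f z)"

definition URSM :: "complex set \<Rightarrow> bool" where
  "URSM S \<longleftrightarrow> (\<forall>f g. nonconst_meromorphic f \<longrightarrow> nonconst_meromorphic g \<longrightarrow>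
     E_set f S = E_set g S \<longrightarrow> f = g)"

definition URSE :: "complex set \<Rightarrow> bool" where
  "URSE S \<longleftrightarrow> (\<forall>f g. nonconst_entire f \<longrightarrow> nonconst_entire g \<longrightarrow>
     E_set f S = E_set g S \<longrightarrow> f = g)"

definition URSM_trunc :: "enat \<Rightarrow> complex set \<Rightarrow> bool" where
  "URSM_trunc l S \<longleftrightarrow> (\<forall>f g. nonconst_meromorphic f \<longrightarrow> nonconst_meromorphic g \<longrightarrow>
     E_trunc f S l = E_trunc g S l \<longrightarrow> f = g)"

definition URSE_trunc :: "enat \<Rightarrow> complex set \<Rightarrow> bool" where
  "URSE_trunc l S \<longleftrightarrow> (\<forall>f g. nonconst_entire f \<longrightarrow> nonconst_entire g \<longrightarrow>
     E_trunc f S l = E_trunc g S l \<longrightarrow> f = g)"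

end

theory Submission
  imports Defs "HOL-Computational_Algebra.Fundamental_Theorem_Algebra"
begin

text \<open>
  Truncation commutes with the union over \<open>S\<close>, so only one implication has content, and it suffices
  that equality of the truncated multisets forces equality of the multisets. The expected tool is
  Nevanlinna theory; it is replaced here by an Ahlfors--Schwarz argument.

  Put \<open>A\<^sub>f = f' P'(f) / P(f)\<^sup>2\<close>, the derivative of \<open>- 1 / P(f)\<close>, and let \<open>H\<close> be the logarithmic derivative
  of \<open>A\<^sub>f / A\<^sub>g\<close>. If a common root point has different multiplicities for \<open>f\<close> and \<open>g\<close>, then \<open>H\<close> has a
  pole there. On the other hand, a product \<open>U\<close> of powers of \<open>|f'|\<close>, \<open>|g'|\<close>, \<open>|H|\<close>, \<open>|P(f)|\<close>, \<open>|P(g)|\<close>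
  and of the distances from \<open>f\<close>, \<open>g\<close> to the zeros of \<open>P'\<close>, corrected by factors
  \<open>|h|\<^sup>\<epsilon> + |h|\<^sup>-\<^sup>\<epsilon>\<close> of small exponent, is a continuous metric that satisfies
  \<open>U \<le> K (\<Delta> log U)\<^sup>w\<close> where it is positive. Such a metric vanishes on the whole plane, hence \<open>H = 0\<close>.
  Continuity of \<open>U\<close> at poles needs \<open>n \<ge> 2 k + 7\<close>; everything else needs only \<open>n \<ge> 2 k + 3\<close>. The truncation
  level enters in that \<open>H\<close> vanishes at common simple roots, is finite at common double roots, and has
  at most a simple pole at the others, where both multiplicities are at least 3.
\<close>

section \<open>Laplacians and the Ahlfors--Schwarz argument\<close>

text \<open>Logarithms of moduli of analytic functions are harmonic, so a plain product of powers
  has no curvature. The correcting factors create it: each is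
  \<open>2 cosh (\<epsilon> ln |h|)\<close>, and a strictly convex function of a harmonic one has a
  Laplacian proportional to \<open>|h'/h|^2\<close>. Taking \<open>h = f - s\<close>,
  \<open>g - s\<close> and \<open>A_f / A_g\<close> brings \<open>|f'|\<close>, \<open>|g'|\<close>
  and \<open>|H|\<close> into the curvature. The main exponents are forced by orders of vanishing.
  In \<open>|f'|^2 |B(f)|^2 / |P(f)|\<close>, where \<open>B\<close> has each zero of
  \<open>P'\<close> once, a root point of multiplicity \<open>m\<close> has order
  \<open>m - 2\<close>, a zero of \<open>B(f)\<close> or of \<open>f'\<close> off the roots has
  order at least 2, and a pole of order \<open>q\<close> has order
  \<open>(n - 2 k - 2) q - 2\<close>. A simple pole of \<open>H\<close> costs 2. Some of these
  balances are exactly 0, hence the perturbation by multiples of \<epsilon>. The bound by the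
  curvature is a separate matter: at infinity \<open>|B(w)|^2 / |P(w)|\<close> has size
  \<open>|w|^(2 k - n)\<close>, to be dominated by \<open>|w|^(-2)\<close>.\<close>

definition has_second_deriv :: "(real \<Rightarrow> real) \<Rightarrow> real \<Rightarrow> bool" where
  "has_second_deriv \<phi> l \<longleftrightarrow>
     (\<exists>d. (\<forall>\<^sub>F t in nhds 0. (\<phi> has_real_derivative d t) (at t)) \<and> (d has_real_derivative l) (at 0))"

text \<open>Second derivatives along the two coordinate lines suffice for a maximum principle and
  reduce every computation to one real variable. A relation is used, so existence and value are
  carried together.\<close>

definition has_laplacian :: "(complex \<Rightarrow> real) \<Rightarrow> complex \<Rightarrow> real \<Rightarrow> bool" where
  "has_laplacian u z l \<longleftrightarrow>
     (\<exists>l1 l2. has_second_deriv (\<lambda>t. u (z + of_real t)) l1 \<and>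
              has_second_deriv (\<lambda>t. u (z + of_real t * \<i>)) l2 \<and> l = l1 + l2)"

lemma has_second_derivI:
  assumes "\<forall>\<^sub>F t in nhds 0. (\<phi> has_real_derivative d t) (at t)" "(d has_real_derivative l) (at 0)"
  shows "has_second_deriv \<phi> l"
  using assms unfolding has_second_deriv_def by blast

lemma has_second_deriv_add:
  assumes "has_second_deriv \<phi> l" "has_second_deriv \<psi> m"
  shows "has_second_deriv (\<lambda>t. \<phi> t + \<psi> t) (l + m)"
proof -
  obtain d where d: "\<forall>\<^sub>F t in nhds 0. (\<phi> has_real_derivative d t) (at t)" "(d has_real_derivative l) (at 0)"
    using assms(1) unfolding has_second_deriv_def by blast
  obtain e where e: "\<forall>\<^sub>F t in nhds 0. (\<psi> has_real_derivative e t) (at t)" "(e has_real_derivative m) (at 0)"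
    using assms(2) unfolding has_second_deriv_def by blast
  show ?thesis
    unfolding has_second_deriv_def
    by (rule exI[of _ "\<lambda>t. d t + e t"])
       (auto intro!: derivative_eq_intros d(2) e(2) eventually_mono[OF eventually_conj[OF d(1) e(1)]])
qed

lemma has_second_deriv_cmult:
  assumes "has_second_deriv \<phi> l"
  shows "has_second_deriv (\<lambda>t. c * \<phi> t) (c * l)"
proof -
  obtain d where d: "\<forall>\<^sub>F t in nhds 0. (\<phi> has_real_derivative d t) (at t)" "(d has_real_derivative l) (at 0)"
    using assms(1) unfolding has_second_deriv_def by blast
  show ?thesis
    unfolding has_second_deriv_def
    by (rule exI[of _ "\<lambda>t. c * d t"])
       (auto intro!: derivative_eq_intros d(2) eventually_mono[OF d(1)])
qed

lemma has_second_deriv_cong: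
  assumes "has_second_deriv \<phi> l" "\<forall>\<^sub>F t in nhds 0. \<phi> t = \<psi> t"
  shows "has_second_deriv \<psi> l"
proof -
  obtain d where d: "\<forall>\<^sub>F t in nhds 0. (\<phi> has_real_derivative d t) (at t)" "(d has_real_derivative l) (at 0)"
    using assms(1) unfolding has_second_deriv_def by blast
  have "\<forall>\<^sub>F t in nhds 0. \<forall>\<^sub>F s in nhds t. \<phi> s = \<psi> s"
    using assms(2) by (simp add: eventually_eventually)
  hence "\<forall>\<^sub>F t in nhds 0. (\<psi> has_real_derivative d t) (at t)"
    using d(1) by eventually_elim (use DERIV_cong_ev in blast)
  thus ?thesis
    using d(2) unfolding has_second_deriv_def by blast
qed

lemma has_second_deriv_compose:
  assumes "has_second_deriv \<phi> l" "(\<phi> has_real_derivative \<phi>') (at 0)"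
    and "\<And>x. (F has_real_derivative F' x) (at x)" "\<And>x. (F' has_real_derivative F'' x) (at x)"
  shows "has_second_deriv (\<lambda>t. F (\<phi> t)) (F'' (\<phi> 0) * \<phi>'\<^sup>2 + F' (\<phi> 0) * l)"
proof -
  obtain d where d: "\<forall>\<^sub>F t in nhds 0. (\<phi> has_real_derivative d t) (at t)" "(d has_real_derivative l) (at 0)"
    using assms(1) unfolding has_second_deriv_def by blast
  have "d 0 = \<phi>'"
    using eventually_nhds_x_imp_x[OF d(1)] assms(2) DERIV_unique by blast
  have "\<forall>\<^sub>F t in nhds 0. ((\<lambda>t. F (\<phi> t)) has_real_derivative F' (\<phi> t) * d t) (at t)"
    using d(1) by eventually_elim (rule DERIV_chain2[OF assms(3)])
  moreover have "((\<lambda>t. F' (\<phi> t) * d t) has_real_derivative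
      F'' (\<phi> 0) * \<phi>'\<^sup>2 + F' (\<phi> 0) * l) (at 0)"
    by (auto intro!: derivative_eq_intros DERIV_chain2[OF assms(4) assms(2)] d(2)
        simp: \<open>d 0 = \<phi>'\<close> power2_eq_square algebra_simps)
  ultimately show ?thesis by (rule has_second_derivI)
qed

text \<open>If \<open>l\<close> were positive, the first derivative, which vanishes at the maximum,
  would be positive just to its right, and \<open>\<phi>\<close> would rise above
  \<open>\<phi> 0\<close>.\<close>

lemma has_second_deriv_local_max:
  assumes "has_second_deriv \<phi> l" "\<forall>\<^sub>F t in nhds 0. \<phi> t \<le> \<phi> 0"
  shows "l \<le> 0"
proof (rule ccontr)
  assume "\<not> l \<le> 0"
  obtain d where d: "\<forall>\<^sub>F t in nhds 0. (\<phi> has_real_derivative d t) (at t)" "(d has_real_derivative l) (at 0)"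
    using assms(1) unfolding has_second_deriv_def by blast
  have *: "\<forall>\<^sub>F t in nhds 0. \<phi> t \<le> \<phi> 0 \<and> (\<phi> has_real_derivative d t) (at t)"
    using assms(2) d(1) by eventually_elim auto
  then obtain r where r: "r > 0" "\<And>t. \<bar>t\<bar> < r \<Longrightarrow> \<phi> t \<le> \<phi> 0 \<and> (\<phi> has_real_derivative d t) (at t)"
    unfolding eventually_nhds_metric by (auto simp: dist_norm)
  have "d 0 = 0"
    by (rule DERIV_local_max[of \<phi> "d 0" 0 r]) (use r in auto)
  obtain s where s: "s > 0" "\<And>h. 0 < h \<Longrightarrow> h < s \<Longrightarrow> d 0 < d (0 + h)"
    using DERIV_pos_inc_right[OF d(2)] \<open>\<not> l \<le> 0\<close> by auto
  define x where "x = min r s / 2"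
  have x: "0 < x" "x < r" "x < s" using r s by (auto simp: x_def)
  obtain y where y: "0 < y" "y < x" "\<phi> x - \<phi> 0 = (x - 0) * d y"
    using MVT2[of 0 x \<phi> d] r(2) x by force
  have "d y > 0" using s(2)[of y] y x \<open>d 0 = 0\<close> by auto
  hence "\<phi> x > \<phi> 0" using y(3) x by (smt (verit) mult_pos_pos)
  thus False using r(2)[of x] x by auto
qed

lemma has_laplacian_add:
  "has_laplacian u z l \<Longrightarrow> has_laplacian v z m \<Longrightarrow> has_laplacian (\<lambda>w. u w + v w) z (l + m)"
  unfolding has_laplacian_def by (force dest: has_second_deriv_add)

lemma has_laplacian_cmult:
  "has_laplacian u z l \<Longrightarrow> has_laplacian (\<lambda>w. c * u w) z (c * l)"
  unfolding has_laplacian_def by (force dest: has_second_deriv_cmult simp: distrib_left)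

lemma has_laplacian_const: "has_laplacian (\<lambda>_. c) z 0"
proof -
  have "has_second_deriv (\<lambda>_. c) 0"
    unfolding has_second_deriv_def by (auto intro!: exI[of _ "\<lambda>_. 0"])
  thus ?thesis unfolding has_laplacian_def by fastforce
qed

lemma has_laplacian_sum:
  assumes "finite I" "\<And>i. i \<in> I \<Longrightarrow> has_laplacian (u i) z (l i)"
  shows "has_laplacian (\<lambda>w. \<Sum>i\<in>I. u i w) z (\<Sum>i\<in>I. l i)"
  using assms by (induction I) (auto intro!: has_laplacian_add has_laplacian_const)

lemma filterlim_line:
  fixes z v :: complex
  shows "filterlim (\<lambda>t. z + of_real t * v) (nhds z) (nhds (0::real))"
proof -
  have "((\<lambda>t::real. z + of_real t * v) \<longlongrightarrow> z + of_real 0 * v) (nhds 0)"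
    by (intro tendsto_intros) (simp_all add: filterlim_ident)
  thus ?thesis by simp
qed

lemma eventually_line:
  assumes "\<forall>\<^sub>F w in nhds z. P w"
  shows "\<forall>\<^sub>F t in nhds (0::real). P (z + of_real t * v :: complex)"
  using eventually_compose_filterlim[OF assms filterlim_line] .

lemma has_laplacian_cong:
  assumes "has_laplacian u z l" "\<forall>\<^sub>F w in nhds z. u w = v w"
  shows "has_laplacian v z l"
  using assms has_second_deriv_cong eventually_line[OF assms(2), of 1] eventually_line[OF assms(2), of \<i>]
  unfolding has_laplacian_def by (smt (verit) mult.right_neutral eventually_mono)

lemma has_laplacian_local_max:
  assumes "has_laplacian u z l" "\<forall>\<^sub>F w in nhds z. u w \<le> u z"
  shows "l \<le> 0"
proof -
  obtain l1 l2 where l: "has_second_deriv (\<lambda>t. u (z + of_real t)) l1"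
    "has_second_deriv (\<lambda>t. u (z + of_real t * \<i>)) l2" "l = l1 + l2"
    using assms(1) unfolding has_laplacian_def by blast
  have "l1 \<le> 0"
    by (rule has_second_deriv_local_max[OF l(1)]) (use eventually_line[OF assms(2), of 1] in simp)
  moreover have "l2 \<le> 0"
    by (rule has_second_deriv_local_max[OF l(2)]) (use eventually_line[OF assms(2), of \<i>] in simp)
  ultimately show ?thesis using l(3) by simp
qed

section \<open>Harmonicity of \<open>ln |h|\<close> and the sources of curvature\<close>

lemma line_has_vector_derivative:
  fixes z v :: complex
  assumes "(h has_field_derivative h') (at (z + of_real t * v))"
  shows "((\<lambda>t. h (z + of_real t * v)) has_vector_derivative v * h') (at (t::real))"
proof -
  have "((\<lambda>t. z + of_real t * v) has_vector_derivative v) (at t)"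
    by (auto intro!: derivative_eq_intros)
  from field_vector_diff_chain_at[OF this assms] show ?thesis by (simp add: o_def)
qed

lemma Re_line_has_real_derivative:
  fixes z v :: complex
  assumes "(h has_field_derivative h') (at (z + of_real t * v))"
  shows "((\<lambda>t. Re (h (z + of_real t * v))) has_real_derivative Re (v * h')) (at (t::real))"
  using bounded_linear.has_vector_derivative[OF bounded_linear_Re line_has_vector_derivative[OF assms]]
  by (simp add: has_real_derivative_iff_has_vector_derivative)

lemma eventually_analytic_nhds:
  assumes "h analytic_on {z}"
  shows "\<forall>\<^sub>F w in nhds z. h analytic_on {w}"
proof -
  obtain s where s: "open s" "z \<in> s" "h holomorphic_on s"
    using assms analytic_at by blast
  have "\<forall>\<^sub>F w in nhds z. w \<in> s"
    using s by (intro eventually_nhds_in_open)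
  thus ?thesis by eventually_elim (use s analytic_at in blast)
qed

lemma eventually_analytic_nonzero:
  assumes "h analytic_on {z}" "h z \<noteq> 0"
  shows "\<forall>\<^sub>F w in nhds z. h analytic_on {w} \<and> h w \<noteq> 0"
proof -
  have "isCont h z" by (rule analytic_at_imp_isCont) fact
  hence "\<forall>\<^sub>F w in nhds z. h w \<noteq> 0"
    using assms(2) tendsto_imp_eventually_ne[of h "h z" "at z" 0]
    by (simp add: isCont_def eventually_nhds_conv_at)
  thus ?thesis using eventually_analytic_nhds[OF assms(1)] by eventually_elim simp
qed

text \<open>In direction \<open>v\<close> the derivative of \<open>ln |h|\<close> is
  \<open>Re (v h'/h)\<close>, hence the second one is \<open>Re (v^2 (h'/h)')\<close>; the values
  for \<open>v = 1\<close> and \<open>v = \<i>\<close> cancel. The first derivative is recorded as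
  well because composition with a convex function squares it.\<close>

lemma has_laplacian_ln_norm_aux:
  fixes h :: "complex \<Rightarrow> complex" and v :: complex
  assumes "h analytic_on {z}" "h z \<noteq> 0"
  shows "has_second_deriv (\<lambda>t. ln (norm (h (z + of_real t * v)))) (Re (v\<^sup>2 * deriv (\<lambda>w. deriv h w / h w) z))"
    and "((\<lambda>t. ln (norm (h (z + of_real t * v)))) has_real_derivative Re (v * (deriv h z / h z))) (at 0)"
proof -
  define q where "q = (\<lambda>w. deriv h w / h w)"
  have ev: "\<forall>\<^sub>F w in nhds z. h analytic_on {w} \<and> h w \<noteq> 0"
    by (rule eventually_analytic_nonzero) fact+
  have D: "((\<lambda>t. ln (norm (h (z + of_real t * v)))) has_real_derivative Re (v * q (z + of_real t * v))) (at t)"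
    if "h analytic_on {z + of_real t * v}" "h (z + of_real t * v) \<noteq> 0" for t :: real
  proof -
    define w where "w = z + of_real t * v"
    have "(h has_field_derivative deriv h w) (at w)"
      using that by (simp add: analytic_on_imp_differentiable_at DERIV_deriv_iff_field_differentiable w_def)
    from line_has_vector_derivative[OF this[unfolded w_def]]
    have 1: "((\<lambda>t. h (z + of_real t * v)) has_vector_derivative v * deriv h w) (at t)" by (simp add: w_def)
    have 2: "((\<lambda>t. (norm (h (z + of_real t * v)))\<^sup>2) has_real_derivative 2 * (h w \<bullet> (v * deriv h w))) (at t)"
      unfolding power2_norm_eq_inner has_real_derivative_iff_has_vector_derivative
      using bounded_bilinear.has_vector_derivative[OF bounded_bilinear_inner 1 1]
      by (simp add: w_def inner_commute)
    have 3: "((\<lambda>t. ln ((norm (h (z + of_real t * v)))\<^sup>2) / 2) has_real_derivative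
       (2 * (h w \<bullet> (v * deriv h w)) / (norm (h w))\<^sup>2) / 2) (at t)"
      using DERIV_cdivide[OF DERIV_chain2[OF DERIV_ln_divide 2], of 2] that by (simp add: w_def)
    have 4: "(\<lambda>t. ln ((norm (h (z + of_real t * v)))\<^sup>2) / 2) = (\<lambda>t. ln (norm (h (z + of_real t * v))))"
      by (auto simp: ln_realpow fun_eq_iff)
    have 5: "(2 * (h w \<bullet> (v * deriv h w)) / (norm (h w))\<^sup>2) / 2 = Re (v * q w)"
    proof -
      have "v * q w = (v * deriv h w * cnj (h w)) / of_real ((norm (h w))\<^sup>2)"
        unfolding q_def times_divide_eq_right complex_div_cnj[of "v * deriv h w"] by simp
      hence "Re (v * q w) = Re (v * deriv h w * cnj (h w)) / (norm (h w))\<^sup>2"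
        by (simp only: Re_divide_of_real)
      also have "Re (v * deriv h w * cnj (h w)) = h w \<bullet> (v * deriv h w)"
        by (simp add: inner_complex_def)
      finally show ?thesis by simp
    qed
    show ?thesis using 3 unfolding 4 5 by (simp add: w_def)
  qed
  have "q analytic_on {z}" unfolding q_def by (intro analytic_intros assms) (use assms in auto)
  hence "(q has_field_derivative deriv q z) (at z)"
    by (simp add: analytic_on_imp_differentiable_at DERIV_deriv_iff_field_differentiable)
  hence "((\<lambda>w. v * q w) has_field_derivative v * deriv q z) (at (z + of_real 0 * v))"
    by (auto intro!: derivative_eq_intros)
  from Re_line_has_real_derivative[OF this]
  have "((\<lambda>t. Re (v * q (z + of_real t * v))) has_real_derivative Re (v\<^sup>2 * deriv q z)) (at 0)"
    by (simp add: power2_eq_square mult.assoc)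
  moreover have "\<forall>\<^sub>F t in nhds 0. ((\<lambda>t. ln (norm (h (z + of_real t * v)))) has_real_derivative Re (v * q (z + of_real t * v))) (at t)"
    using eventually_line[OF ev, of v] by eventually_elim (use D in blast)
  ultimately show "has_second_deriv (\<lambda>t. ln (norm (h (z + of_real t * v)))) (Re (v\<^sup>2 * deriv (\<lambda>w. deriv h w / h w) z))"
    unfolding q_def by (rule has_second_derivI[rotated])
  show "((\<lambda>t. ln (norm (h (z + of_real t * v)))) has_real_derivative Re (v * (deriv h z / h z))) (at 0)"
    using D[of 0] assms by (simp add: q_def)
qed

lemma has_laplacian_ln_norm:
  assumes "h analytic_on {z}" "h z \<noteq> 0"
  shows "has_laplacian (\<lambda>w. ln (norm (h w))) z 0"
  using has_laplacian_ln_norm_aux(1)[OF assms, of 1] has_laplacian_ln_norm_aux(1)[OF assms, of \<i>]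
  unfolding has_laplacian_def by force

text \<open>Off 0 this is \<open>2 cosh (\<epsilon> ln |w|)\<close>, symmetric under inversion of
  \<open>w\<close>. At \<open>w = 0\<close> the convention for \<open>powr\<close> makes the value
  0, not infinity.\<close>

definition cpow :: "real \<Rightarrow> complex \<Rightarrow> real" where
  "cpow \<epsilon> w = norm w powr \<epsilon> + norm w powr (-\<epsilon>)"

lemma cpow_pos: "w \<noteq> 0 \<Longrightarrow> cpow \<epsilon> w > 0"
  unfolding cpow_def by (simp add: add_pos_pos)

lemma cpow_eq_cosh: "w \<noteq> 0 \<Longrightarrow> cpow \<epsilon> w = 2 * cosh (\<epsilon> * ln (norm w))"
  unfolding cpow_def cosh_def by (simp add: powr_def)

text \<open>For harmonic \<open>u = ln |h|\<close> the Laplacian of \<open>F(u)\<close> is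
  \<open>F''(u) |grad u|^2\<close> with \<open>|grad u| = |h'/h|\<close>; the terms with
  \<open>F'\<close> cancel between the two directions. The factor 4 appears because
  \<open>cosh\<close> is half of \<open>cpow\<close>.\<close>

lemma has_laplacian_ln_cpow:
  assumes "h analytic_on {z}" "h z \<noteq> 0"
  shows "has_laplacian (\<lambda>w. ln (cpow \<epsilon> (h w))) z (4 * \<epsilon>\<^sup>2 * (norm (deriv h z / h z) / cpow \<epsilon> (h z))\<^sup>2)"
proof -
  define F where "F = (\<lambda>x::real. ln (2 * cosh (\<epsilon> * x)))"
  define F' where "F' = (\<lambda>x. \<epsilon> * tanh (\<epsilon> * x))"
  define F'' where "F'' = (\<lambda>x. \<epsilon>\<^sup>2 / (cosh (\<epsilon> * x))\<^sup>2)"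
  have F: "(F has_real_derivative F' x) (at x)" for x
    unfolding F_def F'_def by (auto intro!: derivative_eq_intros simp: tanh_def field_simps)
  have F': "(F' has_real_derivative F'' x) (at x)" for x
    unfolding F'_def F''_def
    by (auto intro!: derivative_eq_intros simp: tanh_def power2_eq_square divide_simps)
       (simp add: algebra_simps cosh_square_eq flip: power2_eq_square)
  define u where "u = (\<lambda>w. ln (norm (h w)))"
  define q where "q = deriv h z / h z"
  define q' where "q' = deriv (\<lambda>w. deriv h w / h w) z"
  have 1: "has_second_deriv (\<lambda>t. F (u (z + of_real t * v))) (F'' (u z) * (Re (v * q))\<^sup>2 + F' (u z) * Re (v\<^sup>2 * q'))" for v
    using has_second_deriv_compose[OF has_laplacian_ln_norm_aux[OF assms] F F', of v]
    by (simp add: q_def q'_def u_def)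
  have "has_laplacian (\<lambda>w. F (u w)) z (F'' (u z) * (norm q)\<^sup>2)"
    unfolding has_laplacian_def
  proof (intro exI conjI)
    show "has_second_deriv (\<lambda>t. F (u (z + of_real t))) (F'' (u z) * (Re q)\<^sup>2 + F' (u z) * Re q')"
      using 1[of 1] by simp
    show "has_second_deriv (\<lambda>t. F (u (z + of_real t * \<i>))) (F'' (u z) * (Im q)\<^sup>2 - F' (u z) * Re q')"
      using 1[of \<i>] by simp
    show "F'' (u z) * (norm q)\<^sup>2 = F'' (u z) * (Re q)\<^sup>2 + F' (u z) * Re q' +
        (F'' (u z) * (Im q)\<^sup>2 - F' (u z) * Re q')"
      by (simp add: cmod_power2 distrib_left)
  qed
  moreover have "F'' (u z) * (norm q)\<^sup>2 = 4 * \<epsilon>\<^sup>2 * (norm (deriv h z / h z) / cpow \<epsilon> (h z))\<^sup>2"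
    using assms by (simp add: F''_def u_def q_def cpow_eq_cosh field_simps)
  moreover have "\<forall>\<^sub>F w in nhds z. h w \<noteq> 0"
    using eventually_analytic_nonzero[OF assms] by eventually_elim simp
  hence "\<forall>\<^sub>F w in nhds z. F (u w) = ln (cpow \<epsilon> (h w))"
    by eventually_elim (simp add: F_def u_def cpow_eq_cosh)
  ultimately show ?thesis using has_laplacian_cong[of "\<lambda>w. F (u w)"] by simp
qed

text \<open>The hyperbolic density of the disc of radius \<open>R\<close> is a constant over
  \<open>R^2 - |w|^2\<close>; the formula expresses its constant negative curvature.\<close>

lemma has_laplacian_ln_poincare:
  assumes "norm z < R"
  shows "has_laplacian (\<lambda>w. ln (R\<^sup>2 - (norm w)\<^sup>2)) z (- 4 * R\<^sup>2 / (R\<^sup>2 - (norm z)\<^sup>2)\<^sup>2)"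
proof -
  define b where "b = (\<lambda>v. Re (z * cnj v))"
  define D where "D = R\<^sup>2 - (norm z)\<^sup>2"
  have "D > 0" using assms by (simp add: D_def power_strict_mono)
  have 1: "has_second_deriv (\<lambda>t. ln (R\<^sup>2 - (norm (z + of_real t * v))\<^sup>2)) (- 2 / D - 4 * (b v)\<^sup>2 / D\<^sup>2)"
    if "norm v = 1" for v
  proof -
    define g where "g = (\<lambda>t::real. D - 2 * t * b v - t\<^sup>2)"
    have g: "R\<^sup>2 - (norm (z + of_real t * v))\<^sup>2 = g t" for t
    proof -
      have "(norm v)\<^sup>2 = 1" using that by simp
      hence "(Re v)\<^sup>2 + (Im v)\<^sup>2 = 1" by (simp add: cmod_power2)
      hence "t\<^sup>2 * ((Re v)\<^sup>2 + (Im v)\<^sup>2) = t\<^sup>2" by simp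
      thus ?thesis unfolding g_def D_def b_def cmod_power2
        by (simp add: power2_eq_square algebra_simps)
    qed
    have "isCont g 0" unfolding g_def by (intro continuous_intros)
    hence "\<forall>\<^sub>F t in nhds 0. g t > 0"
      using \<open>D > 0\<close> order_tendstoD(1)[of g "g 0" "at 0" 0] by (simp add: isCont_def eventually_nhds_conv_at g_def)
    hence "\<forall>\<^sub>F t in nhds 0. ((\<lambda>t. ln (g t)) has_real_derivative ((- 2 * b v - 2 * t) / g t)) (at t)"
      by eventually_elim (auto simp: g_def intro!: derivative_eq_intros simp: field_simps)
    moreover have "((\<lambda>t. (- 2 * b v - 2 * t) / g t) has_real_derivative (- 2 / D - 4 * (b v)\<^sup>2 / D\<^sup>2)) (at 0)"
      unfolding g_def using \<open>D > 0\<close> 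
      by (auto intro!: derivative_eq_intros simp: field_simps power2_eq_square)
    ultimately show ?thesis unfolding g by (rule has_second_derivI)
  qed
  have b: "(b 1)\<^sup>2 + (b \<i>)\<^sup>2 = (norm z)\<^sup>2" by (simp add: b_def cmod_power2)
  have "(- 2 / D - 4 * (b 1)\<^sup>2 / D\<^sup>2) + (- 2 / D - 4 * (b \<i>)\<^sup>2 / D\<^sup>2) = - 4 * (D + ((b 1)\<^sup>2 + (b \<i>)\<^sup>2)) / D\<^sup>2"
    using \<open>D > 0\<close> by (simp add: field_simps power2_eq_square)
  also have "\<dots> = - 4 * R\<^sup>2 / D\<^sup>2" unfolding b by (simp add: D_def)
  finally show ?thesis
    unfolding has_laplacian_def D_def[symmetric]
  proof (intro exI conjI)
    show "has_second_deriv (\<lambda>t. ln (R\<^sup>2 - (norm (z + of_real t))\<^sup>2)) (- 2 / D - 4 * (b 1)\<^sup>2 / D\<^sup>2)"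
      using 1[of 1] by simp
    show "has_second_deriv (\<lambda>t. ln (R\<^sup>2 - (norm (z + of_real t * \<i>))\<^sup>2)) (- 2 / D - 4 * (b \<i>)\<^sup>2 / D\<^sup>2)"
      using 1[of \<i>] by simp
  qed (simp only:)
qed

text \<open>Multiplied by a power of \<open>R^2 - |z|^2\<close>, the metric vanishes on the circle
  of radius \<open>R\<close> and has an interior maximum, where the Laplacian of its logarithm is at
  most 0. This bounds \<open>L\<close>, hence \<open>U\<close>. As \<open>R\<close> grows, the left
  side gains \<open>R powr (4 w)\<close> against \<open>R powr (2 w)\<close> on the right.\<close>

lemma ahlfors_schwarz_vanish:
  fixes U :: "complex \<Rightarrow> real"
  assumes cont: "continuous_on UNIV U" and nonneg: "\<And>z. U z \<ge> 0" and "w > 0" "K > 0"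
    and lap: "\<And>z. U z > 0 \<Longrightarrow> \<exists>L\<ge>0. has_laplacian (\<lambda>x. ln (U x)) z L \<and> U z \<le> K * L powr w"
  shows "U z\<^sub>0 = 0"
proof (rule ccontr)
  assume "U z\<^sub>0 \<noteq> 0"
  hence U0: "U z\<^sub>0 > 0" using nonneg[of z\<^sub>0] by simp
  have main: "U z\<^sub>0 * (R\<^sup>2 - (norm z\<^sub>0)\<^sup>2) powr (2 * w) \<le> K * (8 * w * R\<^sup>2) powr w" if R: "R > norm z\<^sub>0" for R
  proof -
    have "R > 0" using R norm_ge_zero[of z\<^sub>0] by linarith
    have pos: "0 < R\<^sup>2 - (norm x)\<^sup>2" if "norm x < R" for x :: complex
      using power_strict_mono[OF that, of 2] by simp
    \<comment> \<open>The exponent \<open>2 w\<close> is the one for which the distance to the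
      boundary cancels: \<open>L\<close> is at most of size \<open>1 / D^2\<close>, so
      \<open>L powr w\<close> is of size \<open>1 / D powr (2 w)\<close>.\<close>
    define Q where "Q = (\<lambda>z. U z * (R\<^sup>2 - (norm z)\<^sup>2) powr (2 * w))"
    have "continuous_on (cball 0 R) Q"
      unfolding Q_def using \<open>w > 0\<close>
      by (intro continuous_intros continuous_on_subset[OF cont] continuous_on_powr')
         (auto intro: power_mono)
    then obtain z where z: "z \<in> cball 0 R" "\<And>y. y \<in> cball 0 R \<Longrightarrow> Q y \<le> Q z"
      using continuous_attains_sup[of "cball 0 R" Q] \<open>R > 0\<close> by auto
    have "Q z\<^sub>0 > 0" using U0 pos[OF R] unfolding Q_def by (simp add: powr_gt_zero)
    hence Qz: "Q z > 0" using z(2)[of z\<^sub>0] R by (simp add: less_imp_le)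
    have Uz: "U z > 0" and Dz: "R\<^sup>2 - (norm z)\<^sup>2 \<noteq> 0"
      using Qz nonneg[of z] unfolding Q_def by (auto simp: zero_less_mult_iff powr_gt_zero)
    have zR: "norm z < R" using z(1) Dz by (cases "norm z = R") auto
    define D where "D = R\<^sup>2 - (norm z)\<^sup>2"
    have "D > 0" using pos[OF zR] by (simp add: D_def)
    obtain L where L: "L \<ge> 0" "has_laplacian (\<lambda>x. ln (U x)) z L" "U z \<le> K * L powr w"
      using lap[OF Uz] by blast
    have "has_laplacian (\<lambda>x. ln (U x) + (2 * w) * ln (R\<^sup>2 - (norm x)\<^sup>2)) z
            (L + (2 * w) * (- 4 * R\<^sup>2 / (R\<^sup>2 - (norm z)\<^sup>2)\<^sup>2))"
      by (intro has_laplacian_add has_laplacian_cmult L has_laplacian_ln_poincare zR)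
    moreover have "\<forall>\<^sub>F x in nhds z. ln (U x) + (2 * w) * ln (R\<^sup>2 - (norm x)\<^sup>2)
        \<le> ln (U z) + (2 * w) * ln (R\<^sup>2 - (norm z)\<^sup>2)"
    proof -
      have ln_Q: "ln (Q x) = ln (U x) + (2 * w) * ln (R\<^sup>2 - (norm x)\<^sup>2)" if "U x > 0" "norm x < R" for x
        unfolding Q_def using that pos[of x] by (simp add: ln_mult)
      have "\<forall>\<^sub>F x in nhds z. x \<in> ball 0 R" using zR by (intro eventually_nhds_in_open) auto
      moreover have "isCont U z" using cont continuous_on_eq_continuous_at by auto
      hence "\<forall>\<^sub>F x in nhds z. U x > 0"
        using Uz order_tendstoD(1)[of U "U z" "at z" 0] by (simp add: isCont_def eventually_nhds_conv_at)
      ultimately show ?thesis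
      proof eventually_elim
        case (elim x)
        have "Q x > 0" unfolding Q_def using elim pos[of x] by simp
        hence "ln (Q x) \<le> ln (Q z)" using z(2)[of x] elim by (simp add: less_imp_le)
        thus ?case using ln_Q elim Uz zR by simp
      qed
    qed
    ultimately have "L + (2 * w) * (- 4 * R\<^sup>2 / D\<^sup>2) \<le> 0"
      unfolding D_def by (rule has_laplacian_local_max)
    hence "L \<le> 8 * w * R\<^sup>2 / D\<^sup>2" by simp
    hence "L powr w \<le> (8 * w * R\<^sup>2 / D\<^sup>2) powr w" using L(1) \<open>w > 0\<close> by (intro powr_mono2) auto
    also have "\<dots> = (8 * w * R\<^sup>2) powr w / D powr (2 * w)"
      using \<open>D > 0\<close> \<open>w > 0\<close> by (simp add: powr_divide powr_powr flip: powr_numeral)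
    finally have "U z \<le> K * ((8 * w * R\<^sup>2) powr w / D powr (2 * w))"
      using L(3) \<open>K > 0\<close> by (smt (verit) mult_left_mono)
    hence "Q z \<le> K * (8 * w * R\<^sup>2) powr w"
      unfolding Q_def D_def[symmetric] using \<open>D > 0\<close> by (simp add: field_simps)
    thus ?thesis using z(2)[of z\<^sub>0] R by (simp add: Q_def)
  qed
  define M where "M = K * (8 * w) powr w * 2 powr (2 * w)"
  \<comment> \<open>Here \<open>x\<close> stands for \<open>R^2\<close>, taken so large that
    \<open>R^2 - |z_0|^2\<close> is at least half of it.\<close>
  have bound: "U z\<^sub>0 * x powr w \<le> M" if x: "x \<ge> (2 * (norm z\<^sub>0 + 1))\<^sup>2" for x
  proof -
    have "x > 0" using x by (smt (verit) norm_ge_zero zero_less_power)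
    have le: "2 * (norm z\<^sub>0 + 1) \<le> sqrt x" using x real_le_rsqrt by blast
    have lt: "norm z\<^sub>0 < sqrt x" using le norm_ge_zero[of z\<^sub>0] by argo
    have "(norm z\<^sub>0)\<^sup>2 \<le> (sqrt x / 2)\<^sup>2" by (rule power_mono) (use le in auto)
    hence "(norm z\<^sub>0)\<^sup>2 \<le> x / 4" using \<open>x > 0\<close> by (simp add: power_divide)
    hence "x / 2 \<le> (sqrt x)\<^sup>2 - (norm z\<^sub>0)\<^sup>2" using \<open>x > 0\<close> by simp
    hence "U z\<^sub>0 * (x / 2) powr (2 * w) \<le> U z\<^sub>0 * ((sqrt x)\<^sup>2 - (norm z\<^sub>0)\<^sup>2) powr (2 * w)"
      using \<open>x > 0\<close> U0 \<open>w > 0\<close> by (intro mult_left_mono powr_mono2) auto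
    also have "\<dots> \<le> K * (8 * w * (sqrt x)\<^sup>2) powr w"
      by (rule main[OF lt])
    also have "\<dots> = K * (8 * w) powr w * x powr w" using \<open>x > 0\<close> \<open>w > 0\<close> by (simp add: powr_mult)
    also have "(x / 2) powr (2 * w) = x powr w * x powr w / 2 powr (2 * w)"
      using \<open>x > 0\<close> by (simp add: powr_divide flip: powr_add)
    finally have "(U z\<^sub>0 * x powr w) * x powr w \<le> M * x powr w"
      unfolding M_def by (simp add: field_simps)
    thus ?thesis using \<open>x > 0\<close> by (simp add: mult_le_cancel_right)
  qed
  \<comment> \<open>Chosen so that \<open>U z\<^sub>0 * y powr w = M + U z\<^sub>0\<close>, which
    exceeds the bound \<open>M\<close>.\<close>
  define y where "y = (M / U z\<^sub>0 + 1) powr (1 / w)"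
  have "M \<ge> 0" using \<open>K > 0\<close> by (simp add: M_def)
  define x where "x = max y ((2 * (norm z\<^sub>0 + 1))\<^sup>2)"
  have "M / U z\<^sub>0 + 1 > 0" using \<open>M \<ge> 0\<close> U0 by (simp add: add_nonneg_pos)
  hence "y powr w = M / U z\<^sub>0 + 1" unfolding y_def using \<open>w > 0\<close> by (simp add: powr_powr)
  moreover have "y powr w \<le> x powr w" unfolding x_def using \<open>w > 0\<close> by (intro powr_mono2) (auto simp: y_def)
  ultimately have "U z\<^sub>0 * x powr w \<ge> U z\<^sub>0 * (M / U z\<^sub>0 + 1)" using U0 by simp
  moreover have "U z\<^sub>0 * (M / U z\<^sub>0 + 1) = M + U z\<^sub>0" using U0 by (simp add: field_simps)
  ultimately show False using bound[of x] U0 by (simp add: x_def)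
qed

section \<open>Local orders\<close>

text \<open>Only a punctured neighbourhood enters, so the conventional value at a pole is harmless.
  Carrying the unit factor \<open>\<phi>\<close> lets orders pass through products, quotients and
  derivatives without evaluating \<open>zorder\<close> of the result.\<close>

definition has_ord :: "(complex \<Rightarrow> complex) \<Rightarrow> complex \<Rightarrow> int \<Rightarrow> bool" where
  "has_ord h z k \<longleftrightarrow>
     (\<exists>\<phi>. \<phi> analytic_on {z} \<and> \<phi> z \<noteq> 0 \<and> (\<forall>\<^sub>F w in at z. h w = \<phi> w * (w - z) powi k))"

lemma has_ordI:
  assumes "\<phi> analytic_on {z}" "\<phi> z \<noteq> 0" "\<forall>\<^sub>F w in at z. h w = \<phi> w * (w - z) powi k"
  shows "has_ord h z k"
  using assms unfolding has_ord_def by blast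

lemma has_ordE:
  assumes "has_ord h z k"
  obtains \<phi> where "\<phi> analytic_on {z}" "\<phi> z \<noteq> 0" "\<forall>\<^sub>F w in at z. h w = \<phi> w * (w - z) powi k"
  using assms unfolding has_ord_def by blast

lemma has_ord_analytic:
  assumes "h analytic_on {z}" "h z \<noteq> 0"
  shows "has_ord h z 0"
  using assms by (intro has_ordI[of h]) auto

lemma has_ord_const: "c \<noteq> 0 \<Longrightarrow> has_ord (\<lambda>_. c) z 0"
  by (intro has_ord_analytic) auto

lemma eventually_at_neq: "\<forall>\<^sub>F w in at z. w \<noteq> z"
  by (simp add: eventually_at_filter)

lemma has_ord_mult:
  assumes "has_ord g z k" "has_ord h z l"
  shows "has_ord (\<lambda>w. g w * h w) z (k + l)"
proof -
  obtain \<phi> where \<phi>: "\<phi> analytic_on {z}" "\<phi> z \<noteq> 0" "\<forall>\<^sub>F w in at z. g w = \<phi> w * (w - z) powi k"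
    using assms(1) by (rule has_ordE)
  obtain \<psi> where \<psi>: "\<psi> analytic_on {z}" "\<psi> z \<noteq> 0" "\<forall>\<^sub>F w in at z. h w = \<psi> w * (w - z) powi l"
    using assms(2) by (rule has_ordE)
  show ?thesis
  proof (rule has_ordI[of "\<lambda>w. \<phi> w * \<psi> w"])
    show "\<forall>\<^sub>F w in at z. g w * h w = \<phi> w * \<psi> w * (w - z) powi (k + l)"
      using \<phi>(3) \<psi>(3) eventually_at_neq
      by eventually_elim (simp add: power_int_add)
  qed (use \<phi> \<psi> in \<open>auto intro!: analytic_intros\<close>)
qed

lemma has_ord_inverse:
  assumes "has_ord h z k"
  shows "has_ord (\<lambda>w. inverse (h w)) z (- k)"
proof -
  obtain \<phi> where \<phi>: "\<phi> analytic_on {z}" "\<phi> z \<noteq> 0" "\<forall>\<^sub>F w in at z. h w = \<phi> w * (w - z) powi k"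
    using assms by (rule has_ordE)
  show ?thesis
  proof (rule has_ordI[of "\<lambda>w. inverse (\<phi> w)"])
    show "\<forall>\<^sub>F w in at z. inverse (h w) = inverse (\<phi> w) * (w - z) powi (- k)"
      using \<phi>(3) by eventually_elim (simp add: power_int_minus)
  qed (use \<phi> in \<open>auto intro!: analytic_intros\<close>)
qed

lemma has_ord_divide:
  assumes "has_ord g z k" "has_ord h z l"
  shows "has_ord (\<lambda>w. g w / h w) z (k - l)"
  using has_ord_mult[OF assms(1) has_ord_inverse[OF assms(2)]] by (simp add: divide_inverse)

lemma has_ord_power:
  assumes "has_ord h z k"
  shows "has_ord (\<lambda>w. h w ^ m) z (int m * k)"
proof (induction m)
  case 0
  show ?case using has_ord_const[of 1] by simp
next
  case (Suc m)
  from has_ord_mult[OF assms this] show ?case by (simp add: algebra_simps)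
qed

lemma has_ord_prod:
  assumes "finite I" "\<And>i. i \<in> I \<Longrightarrow> has_ord (h i) z (k i)"
  shows "has_ord (\<lambda>w. \<Prod>i\<in>I. h i w) z (\<Sum>i\<in>I. k i)"
  using assms by (induction I) (auto intro!: has_ord_mult has_ord_const)

lemma eventually_at_imp_eventually_nhds:
  fixes z :: "'a :: t1_space"
  assumes "\<forall>\<^sub>F w in at z. P w"
  shows "\<forall>\<^sub>F w in at z. \<forall>\<^sub>F y in nhds w. P y"
proof -
  obtain s where s: "open s" "z \<in> s" "\<And>y. y \<in> s \<Longrightarrow> y \<noteq> z \<Longrightarrow> P y"
    using assms unfolding eventually_at_topological by blast
  have "\<forall>\<^sub>F y in nhds w. P y" if "w \<in> s" "w \<noteq> z" for w
  proof -
    have "\<forall>\<^sub>F y in nhds w. y \<in> s - {z}"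
      using s that by (intro eventually_nhds_in_open) auto
    thus ?thesis by eventually_elim (use s in auto)
  qed
  thus ?thesis unfolding eventually_at_topological using s by blast
qed

lemma has_ord_deriv_aux:
  assumes "\<phi> analytic_on {z}" "\<forall>\<^sub>F w in at z. h w = \<phi> w * (w - z) powi k"
  shows "\<forall>\<^sub>F w in at z. h analytic_on {w} \<and>
           deriv h w = (deriv \<phi> w * (w - z) + of_int k * \<phi> w) * (w - z) powi (k - 1)"
proof -
  obtain s where s: "open s" "z \<in> s" "\<phi> holomorphic_on s"
    using assms(1) analytic_at by blast
  have "\<forall>\<^sub>F w in at z. w \<in> s"
    using s by (intro eventually_at_in_open') auto
  thus ?thesis
    using eventually_at_imp_eventually_nhds[OF assms(2)] eventually_at_neq
  proof eventually_elim
    case (elim w)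
    have an: "(\<lambda>w. \<phi> w * (w - z) powi k) analytic_on {w}"
      using elim s analytic_at by (intro analytic_intros) auto
    have "(\<phi> has_field_derivative deriv \<phi> w) (at w)"
      using s elim holomorphic_derivI by blast
    hence "((\<lambda>w. \<phi> w * (w - z) powi k) has_field_derivative
       deriv \<phi> w * (w - z) powi k + (of_int k * (w - z) powi (k - 1)) * \<phi> w) (at w)"
      using elim by (auto intro!: derivative_eq_intros)
    hence "deriv (\<lambda>w. \<phi> w * (w - z) powi k) w
        = deriv \<phi> w * (w - z) powi k + (of_int k * (w - z) powi (k - 1)) * \<phi> w"
      by (rule DERIV_imp_deriv)
    moreover have "(w - z) powi k = (w - z) * (w - z) powi (k - 1)"
      using elim by (simp add: power_int_diff)
    moreover have "deriv h w = deriv (\<lambda>w. \<phi> w * (w - z) powi k) w"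
      using elim(2) by (rule deriv_cong_ev) simp
    moreover have "h analytic_on {w} \<longleftrightarrow> (\<lambda>w. \<phi> w * (w - z) powi k) analytic_on {w}"
      using elim(2) by (rule analytic_at_cong) simp
    ultimately show ?case using an by (simp add: algebra_simps)
  qed
qed

lemma has_ord_deriv:
  assumes "has_ord h z k" "k \<noteq> 0"
  shows "has_ord (deriv h) z (k - 1)"
proof -
  obtain \<phi> where \<phi>: "\<phi> analytic_on {z}" "\<phi> z \<noteq> 0" "\<forall>\<^sub>F w in at z. h w = \<phi> w * (w - z) powi k"
    using assms(1) by (rule has_ordE)
  show ?thesis
    using has_ord_deriv_aux[OF \<phi>(1,3)] \<phi>(1,2) \<open>k \<noteq> 0\<close>
    by (intro has_ordI[of "\<lambda>w. deriv \<phi> w * (w - z) + of_int k * \<phi> w"])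
       (auto intro!: analytic_intros elim: eventually_mono)
qed

lemma factored_logderiv:
  assumes "\<phi> analytic_on {z}" "\<phi> z \<noteq> 0" "\<forall>\<^sub>F w in at z. h w = \<phi> w * (w - z) powi k"
  shows "\<forall>\<^sub>F w in at z. deriv h w / h w = of_int k / (w - z) + deriv \<phi> w / \<phi> w"
proof -
  have "\<forall>\<^sub>F w in at z. \<phi> w \<noteq> 0"
    using eventually_analytic_nonzero[OF assms(1,2)]
    by (auto simp: eventually_at_filter elim: eventually_mono)
  thus ?thesis
    using has_ord_deriv_aux[OF assms(1,3)] assms(3) eventually_at_neq
  proof eventually_elim
    case (elim w)
    define p where "p = (w - z) powi (k - 1)"
    have p: "p \<noteq> 0" "h w = \<phi> w * ((w - z) * p)"
        "deriv h w = (deriv \<phi> w * (w - z) + of_int k * \<phi> w) * p"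
      using elim by (auto simp: p_def power_int_diff)
    have *: "((d * x + c * y) * p) / (y * (x * p)) = c / x + d / y"
      if "x \<noteq> 0" "y \<noteq> 0" for c d x y :: complex
      using that \<open>p \<noteq> 0\<close> by (simp add: field_simps)
    show ?case
      unfolding p(2,3) by (rule *) (use elim in auto)
  qed
qed

lemma has_ord_logderiv:
  assumes "has_ord h z k"
  obtains \<rho> where "\<rho> analytic_on {z}" "\<forall>\<^sub>F w in at z. deriv h w / h w = of_int k / (w - z) + \<rho> w"
proof -
  obtain \<phi> where \<phi>: "\<phi> analytic_on {z}" "\<phi> z \<noteq> 0" "\<forall>\<^sub>F w in at z. h w = \<phi> w * (w - z) powi k"
    using assms(1) by (rule has_ordE)
  show ?thesis
    using \<phi> factored_logderiv[OF \<phi>] by (intro that[of "\<lambda>w. deriv \<phi> w / \<phi> w"]) (auto intro!: analytic_intros)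
qed

lemma has_ord_eventually:
  assumes "has_ord h z k"
  shows "\<forall>\<^sub>F w in at z. h analytic_on {w} \<and> h w \<noteq> 0"
proof -
  obtain \<phi> where \<phi>: "\<phi> analytic_on {z}" "\<phi> z \<noteq> 0" "\<forall>\<^sub>F w in at z. h w = \<phi> w * (w - z) powi k"
    using assms(1) by (rule has_ordE)
  have "\<forall>\<^sub>F w in at z. \<phi> w \<noteq> 0"
    using eventually_analytic_nonzero[OF \<phi>(1,2)] by (auto simp: eventually_at_filter elim: eventually_mono)
  thus ?thesis
    using has_ord_deriv_aux[OF \<phi>(1,3)] \<phi>(3) eventually_at_neq
    by eventually_elim auto
qed

section \<open>Growth exponents of real factors near a point\<close>

lemma has_ord_bigtheta:
  assumes "has_ord h z k"
  shows "(\<lambda>w. norm (h w)) \<in> \<Theta>[at z](\<lambda>w. norm (w - z) powr of_int k)"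
proof -
  obtain \<phi> where \<phi>: "\<phi> analytic_on {z}" "\<phi> z \<noteq> 0" "\<forall>\<^sub>F w in at z. h w = \<phi> w * (w - z) powi k"
    using assms(1) by (rule has_ordE)
  have "(\<phi> \<longlongrightarrow> \<phi> z) (at z)"
    using analytic_at_imp_isCont[OF \<phi>(1)] by (simp add: isCont_def)
  hence "((\<lambda>w. norm (\<phi> w) / 1) \<longlongrightarrow> norm (\<phi> z)) (at z)" by (simp add: tendsto_norm)
  hence "(\<lambda>w. norm (\<phi> w)) \<in> \<Theta>[at z](\<lambda>_. 1)"
    using \<phi>(2) by (intro bigthetaI_tendsto[where c = "norm (\<phi> z)"]) auto
  hence "(\<lambda>w. norm (\<phi> w) * norm (w - z) powr of_int k) \<in> \<Theta>[at z](\<lambda>w. 1 * norm (w - z) powr of_int k)"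
    by (intro landau_theta.mult) auto
  moreover have "\<forall>\<^sub>F w in at z. norm (h w) = norm (\<phi> w) * norm (w - z) powr of_int k"
    using \<phi>(3) eventually_at_neq
    by eventually_elim (simp add: norm_mult norm_power_int powr_real_of_int')
  ultimately show ?thesis
    using landau_theta.in_cong[of "\<lambda>w. norm (h w)" "\<lambda>w. norm (\<phi> w) * norm (w - z) powr of_int k"] by simp
qed

lemma norm_powr_bigo_mono:
  fixes z :: complex
  assumes "e' \<le> e"
  shows "(\<lambda>w. norm (w - z) powr e) \<in> O[at z](\<lambda>w. norm (w - z) powr e')"
proof (rule bigoI[of _ 1])
  have "\<forall>\<^sub>F w in at z. dist w z < 1"
    unfolding eventually_at by (rule exI[of _ 1]) auto
  thus "\<forall>\<^sub>F w in at z. norm (norm (w - z) powr e) \<le> 1 * norm (norm (w - z) powr e')"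
    using eventually_at_neq
    by eventually_elim (use assms in \<open>auto simp: dist_norm intro!: powr_mono'\<close>)
qed

lemma has_ord_powr_bigo:
  assumes "has_ord h z k"
  shows "(\<lambda>w. norm (h w) powr c) \<in> O[at z](\<lambda>w. norm (w - z) powr (c * of_int k))"
  using bigtheta_powr[OF has_ord_bigtheta[OF assms], of c]
  by (auto simp: powr_powr mult.commute)

text \<open>For either sign of \<open>k\<close> the larger of the two powers near \<open>z\<close>
  has exponent \<open>- \<epsilon> |k|\<close>; this is the price of a correcting factor.\<close>

lemma has_ord_cpow_bigo:
  assumes "has_ord h z k" "\<epsilon> > 0"
  shows "(\<lambda>w. cpow \<epsilon> (h w)) \<in> O[at z](\<lambda>w. norm (w - z) powr (- \<epsilon> * \<bar>of_int k\<bar>))"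
proof -
  have "(\<lambda>w. norm (h w) powr c) \<in> O[at z](\<lambda>w. norm (w - z) powr (- \<epsilon> * \<bar>of_int k\<bar>))"
    if "\<bar>c\<bar> = \<epsilon>" for c
  proof (rule landau_o.big.trans[OF has_ord_powr_bigo[OF assms(1)] norm_powr_bigo_mono])
    have "\<bar>c * of_int k\<bar> = \<epsilon> * \<bar>of_int k\<bar>" using that by (simp add: abs_mult)
    thus "- \<epsilon> * \<bar>of_int k\<bar> \<le> c * of_int k" by linarith
  qed
  from sum_in_bigo(1)[OF this[of \<epsilon>] this[of "-\<epsilon>"]] show ?thesis
    unfolding cpow_def using assms(2) by simp
qed

lemma norm_powr_bigo_prod:
  fixes z :: complex
  assumes "finite I" "\<And>i. i \<in> I \<Longrightarrow> F i \<in> O[at z](\<lambda>w. norm (w - z) powr e i)"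
  shows "(\<lambda>w. \<Prod>i\<in>I. F i w) \<in> O[at z](\<lambda>w. norm (w - z) powr (\<Sum>i\<in>I. e i))"
  using assms
proof (induction I)
  case empty
  have "(\<lambda>_. 1::real) \<in> O[at z](\<lambda>w. norm (w - z) powr 0)"
    by (rule bigoI[of _ 1]) (use eventually_at_neq[of z] in \<open>auto elim: eventually_mono\<close>)
  thus ?case by simp
next
  case (insert i I)
  thus ?case by (auto simp: powr_add intro!: landau_o.big.mult)
qed

lemma norm_powr_bigo_mult:
  fixes z :: complex and F G :: "complex \<Rightarrow> real"
  assumes "F \<in> O[at z](\<lambda>w. norm (w - z) powr e)" "G \<in> O[at z](\<lambda>w. norm (w - z) powr d)"
  shows "(\<lambda>w. F w * G w) \<in> O[at z](\<lambda>w. norm (w - z) powr (e + d))"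
  using assms by (auto simp: powr_add intro!: landau_o.big.mult)

lemma norm_powr_bigo_tendsto_0:
  fixes z :: complex and F :: "complex \<Rightarrow> real"
  assumes "F \<in> O[at z](\<lambda>w. norm (w - z) powr e)" "e > 0"
  shows "(F \<longlongrightarrow> 0) (at z)"
proof -
  obtain c where c: "\<forall>\<^sub>F w in at z. norm (F w) \<le> c * norm (norm (w - z) powr e)"
    using assms(1) by (elim landau_o.bigE)
  have "((\<lambda>w. norm (w - z)) \<longlongrightarrow> norm (z - z)) (at z)" by (intro tendsto_intros)
  hence "((\<lambda>w. norm (w - z)) \<longlongrightarrow> 0) (at z)" by simp
  hence "((\<lambda>w. norm (w - z) powr e) \<longlongrightarrow> 0) (at z)"
    by (rule tendsto_zero_powrI[OF _ tendsto_const _ assms(2)]) simp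
  hence "((\<lambda>w. c * norm (norm (w - z) powr e)) \<longlongrightarrow> 0) (at z)"
    by (simp add: tendsto_mult_right_zero)
  with c show ?thesis by (rule Lim_null_comparison)
qed

lemma has_ord_zorder:
  assumes "h meromorphic_on {z}" "\<exists>\<^sub>F w in at z. h w \<noteq> 0"
  shows "has_ord h z (zorder h z)"
proof -
  have "isolated_singularity_at h z" "not_essential h z"
    using assms(1) by (auto simp: meromorphic_at_iff)
  from zorder_exist[OF this assms(2)] obtain r where r: "zor_poly h z z \<noteq> 0" "r > 0"
    "zor_poly h z holomorphic_on cball z r"
    "\<And>w. w \<in> cball z r - {z} \<Longrightarrow> h w = zor_poly h z w * (w - z) powi (zorder h z)" by blast
  show ?thesis
  proof (rule has_ordI[of "zor_poly h z"])
    show "zor_poly h z z \<noteq> 0" by (rule r(1))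
    show "zor_poly h z analytic_on {z}"
      using r(2) holomorphic_on_subset[OF r(3) ball_subset_cball] 
      by (intro holomorphic_on_imp_analytic_at[of _ "ball z r"]) auto
    show "\<forall>\<^sub>F w in at z. h w = zor_poly h z w * (w - z) powi (zorder h z)"
      unfolding eventually_at using r(2,4) by (intro exI[of _ r]) (auto simp: dist_commute)
  qed
qed

lemma deriv_diff_const:
  fixes f :: "complex \<Rightarrow> complex"
  shows "deriv (\<lambda>w. f w - c) z = deriv f z"
proof -
  have "((\<lambda>w. f w - c) has_field_derivative D) (at z) \<longleftrightarrow> (f has_field_derivative D) (at z)" for D
    using DERIV_diff[OF _ DERIV_const[of c], of f D z UNIV]
      DERIV_add[OF _ DERIV_const[of c], of "\<lambda>w. f w - c" D z UNIV] by auto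
  thus ?thesis by (simp add: deriv_def)
qed

text \<open>The order of \<open>f - c\<close> is given as a function of \<open>c\<close>: constant
  at a pole, supported on \<open>c = f z\<close> elsewhere. All later orders are sums of its values.
  Non-constancy enters through the identity theorem, by which \<open>f\<close> cannot take a value
  \<open>c\<close> frequently near \<open>z\<close>.\<close>

lemma nonconst_meromorphic_local:
  assumes "nonconst_meromorphic f"
  shows "(\<exists>q>0. is_pole f z \<and> (\<forall>c. has_ord (\<lambda>w. f w - c) z (- q)) \<and> has_ord (deriv f) z (- q - 1)) \<or>
         (\<exists>m>0. \<not> is_pole f z \<and> f analytic_on {z} \<and>
            (\<forall>c. has_ord (\<lambda>w. f w - c) z (if c = f z then m else 0)) \<and> has_ord (deriv f) z (m - 1) \<and>
            m = zorder (\<lambda>w. f w - f z) z)"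
proof -
  have f: "f nicely_meromorphic_on UNIV" "\<not> f constant_on UNIV"
    using assms by (auto simp: nonconst_meromorphic_def)
  have mero: "f meromorphic_on {z}"
    using f(1) by (auto simp: nicely_meromorphic_on_def intro: meromorphic_on_subset)
  have freq: "\<exists>\<^sub>F w in at z. f w - c \<noteq> 0" for c
  proof -
    have "\<not> (\<exists>\<^sub>F w in at z. f w = c)"
      using frequently_eq_meromorphic_imp_constant[of f c z UNIV] f by (auto simp: constant_on_def)
    moreover have "\<exists>\<^sub>F w in at z. f w = c" if "\<forall>\<^sub>F w in at z. f w = c"
      using that by (intro eventually_frequently) auto
    ultimately show ?thesis by (auto simp: frequently_def)
  qed
  have ord: "has_ord (\<lambda>w. f w - c) z (zorder (\<lambda>w. f w - c) z)" for c
    by (intro has_ord_zorder freq meromorphic_intros mero)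
  have der: "has_ord (deriv f) z (k - 1)" if "has_ord (\<lambda>w. f w - c) z k" "k \<noteq> 0" for c k
    using has_ord_deriv[OF that] by (simp add: deriv_diff_const[abs_def])
  show ?thesis
  proof (cases "is_pole f z")
    case True
    define q where "q = - zorder f z"
    have "zorder f z < 0"
      using True isolated_pole_imp_neg_zorder[of f z] mero by (auto simp: meromorphic_at_iff)
    have f0: "has_ord f z (- q)" using ord[of 0] by (simp add: q_def)
    \<comment> \<open>Subtracting \<open>c\<close> replaces the unit \<open>\<phi>\<close> by
      \<open>\<phi> - c (w - z)^q\<close>, whose value at \<open>z\<close> is unchanged because
      \<open>q > 0\<close>.\<close>
    have ordc: "has_ord (\<lambda>w. f w - c) z (- q)" for c
    proof -
      obtain \<phi> where \<phi>: "\<phi> analytic_on {z}" "\<phi> z \<noteq> 0" "\<forall>\<^sub>F w in at z. f w = \<phi> w * (w - z) powi (- q)"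
        using f0 by (rule has_ordE)
      have "q > 0" using \<open>zorder f z < 0\<close> by (simp add: q_def)
      show ?thesis
      proof (rule has_ordI[of "\<lambda>w. \<phi> w - c * (w - z) ^ nat q"])
        show "\<forall>\<^sub>F w in at z. f w - c = (\<phi> w - c * (w - z) ^ nat q) * (w - z) powi (- q)"
          using \<phi>(3) eventually_at_neq
          by eventually_elim (use \<open>q > 0\<close> in \<open>simp add: power_int_def field_simps\<close>)
      qed (use \<phi> \<open>q > 0\<close> in \<open>auto intro!: analytic_intros\<close>)
    qed
    have "has_ord (deriv f) z (- q - 1)"
      using der[OF ordc] \<open>zorder f z < 0\<close> by (simp add: q_def)
    thus ?thesis using True ordc \<open>zorder f z < 0\<close> by (intro disjI1 exI[of _ q]) (auto simp: q_def)
  next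
    case False
    have an: "f analytic_on {z}"
      using nicely_meromorphic_on_imp_analytic_at[OF f(1) _ False] by simp
    define m where "m = zorder (\<lambda>w. f w - f z) z"
    have "m > 0"
    proof -
      obtain s where s: "open s" "z \<in> s" "f holomorphic_on s" using an analytic_at by blast
      obtain r where r: "r > 0" "ball z r \<subseteq> s" using s openE by blast
      have "\<exists>w\<in>ball z r. f w - f z \<noteq> 0"
        using frequently_eventually_frequently[OF freq[of "f z"] eventually_at_ball[OF r(1), of z UNIV]]
        using frequently_ex by (fastforce simp: dist_commute)
      hence "if f z - f z = 0 then m > 0 else m = 0"
        unfolding m_def using r s
        by (intro zorder_exist_zero[of "\<lambda>w. f w - f z" "ball z r" z, THEN conjunct1])
           (auto intro!: holomorphic_intros intro: holomorphic_on_subset)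
      thus ?thesis by simp
    qed
    have ordc: "has_ord (\<lambda>w. f w - c) z (if c = f z then m else 0)" for c
    proof -
      have "(\<lambda>w. f w - c) analytic_on {z}" by (intro analytic_intros an)
      thus ?thesis using ord[of "f z"] has_ord_analytic[of "\<lambda>w. f w - c" z] by (auto simp: m_def)
    qed
    show ?thesis
      using der[OF ordc, of "f z"] \<open>m > 0\<close> False an ordc m_def
      by (intro disjI2 exI[of _ m]) auto
  qed
qed

section \<open>Polynomials with simple roots\<close>

lemma ln_cpow_le:
  assumes "w \<noteq> 0" "\<epsilon> > 0"
  shows "ln (cpow \<epsilon> w) \<le> ln 2 + \<epsilon> * \<bar>ln (norm w)\<bar>"
proof -
  have "norm w powr c \<le> exp (\<epsilon> * \<bar>ln (norm w)\<bar>)" if "\<bar>c\<bar> = \<epsilon>" for c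
  proof -
    have "c * ln (norm w) \<le> \<bar>c\<bar> * \<bar>ln (norm w)\<bar>" by (metis abs_ge_self abs_mult)
    thus ?thesis using assms that by (simp add: powr_def)
  qed
  from this[of \<epsilon>] this[of "-\<epsilon>"] have "cpow \<epsilon> w \<le> 2 * exp (\<epsilon> * \<bar>ln (norm w)\<bar>)"
    using assms by (simp add: cpow_def)
  hence "ln (cpow \<epsilon> w) \<le> ln (2 * exp (\<epsilon> * \<bar>ln (norm w)\<bar>))"
    using cpow_pos[OF assms(1)] by (subst ln_le_cancel_iff) auto
  thus ?thesis by (simp add: ln_mult)
qed

lemma ln_norm_prod_diff:
  fixes w :: complex
  assumes "finite I" "w \<notin> I"
  shows "ln (norm (\<Prod>x\<in>I. (w - x) ^ m x)) = (\<Sum>x\<in>I. real (m x) * ln (norm (w - x)))"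
proof -
  have "ln (\<Prod>x\<in>I. norm (w - x) ^ m x) = (\<Sum>x\<in>I. ln (norm (w - x) ^ m x))"
    by (rule ln_prod) (use assms in auto)
  thus ?thesis by (simp add: ln_realpow norm_power flip: prod_norm)
qed

text \<open>At most one root can be close to \<open>w\<close>. With \<open>s\<^sub>0\<close> a
  nearest root, every other root is at distance at least \<open>\<delta>\<close>, half a lower bound
  for the gaps between roots, hence at a distance comparable with \<open>1 + |w|\<close>.\<close>

lemma ln_norm_diff_bounds:
  fixes S T :: "complex set"
  assumes "finite S" "S \<noteq> {}" "finite T"
  obtains C where "C \<ge> 0"
    "\<And>w. \<exists>s\<^sub>0\<in>S. \<forall>s\<in>S - {s\<^sub>0}. ln (1 + norm w) - C \<le> ln (norm (w - s))"
    "\<And>w s. s \<in> S \<union> T \<Longrightarrow> w \<noteq> s \<Longrightarrow> ln (norm (w - s)) \<le> ln (1 + norm w) + C"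
proof -
  obtain M where M: "M \<ge> 1" "\<And>s. s \<in> S \<union> T \<Longrightarrow> norm s \<le> M - 1"
  proof -
    have "bounded (S \<union> T)" using assms by (intro finite_imp_bounded) auto
    then obtain a where "a > 0" "\<forall>s\<in>S \<union> T. norm s \<le> a" using bounded_pos by blast
    thus ?thesis by (intro that[of "a + 1"]) auto
  qed
  obtain \<delta> where \<delta>: "\<delta> > 0" "\<And>s t. s \<in> S \<Longrightarrow> t \<in> S \<Longrightarrow> s \<noteq> t \<Longrightarrow> 2 * \<delta> \<le> dist s t"
  proof -
    have "uniform_discrete S"
      using uniform_discrete_finite_iff[of S] assms(1) by blast
    then obtain \<epsilon> where "\<epsilon> > 0" "\<And>s t. s \<in> S \<Longrightarrow> t \<in> S \<Longrightarrow> dist s t < \<epsilon> \<Longrightarrow> s = t"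
      unfolding uniform_discrete_def by blast
    thus ?thesis by (intro that[of "\<epsilon> / 2"]) force+
  qed
  define C where "C = ln (M / \<delta> + 1) + ln M"
  have pos: "M / \<delta> + 1 \<ge> 1" using M \<delta> by simp
  have C: "ln (M / \<delta> + 1) \<le> C" "ln M \<le> C" "C \<ge> 0"
    unfolding C_def using pos M(1) ln_ge_zero[OF pos] ln_ge_zero[OF M(1)] by auto
  show ?thesis
  proof (rule that[OF C(3)])
    fix w :: complex
    have "Min (dist w ` S) \<in> dist w ` S" using assms(1,2) by (intro Min_in) auto
    then obtain s\<^sub>0 where s0': "s\<^sub>0 \<in> S" "Min (dist w ` S) = dist w s\<^sub>0" by blast
    have s0: "s\<^sub>0 \<in> S" "\<And>s. s \<in> S \<Longrightarrow> dist w s\<^sub>0 \<le> dist w s"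
      using s0' assms(1) Min_le[of "dist w ` S"] by auto
    have "ln (1 + norm w) - C \<le> ln (norm (w - s))" if "s \<in> S - {s\<^sub>0}" for s
    proof -
      have "2 * \<delta> \<le> dist s s\<^sub>0" using \<delta>(2)[of s s\<^sub>0] that s0(1) by auto
      also have "\<dots> \<le> dist w s + dist w s\<^sub>0" by (metis dist_commute dist_triangle)
      also have "\<dots> \<le> 2 * dist w s" using s0(2)[of s] that by simp
      finally have d: "\<delta> \<le> norm (w - s)" by (simp add: dist_norm)
      have "norm w \<le> norm (w - s) + norm s" using norm_triangle_ineq[of "w - s" s] by simp
      hence "1 + norm w \<le> M + norm (w - s)" using M(2)[of s] that by auto
      also have "M \<le> M / \<delta> * norm (w - s)" using d \<delta>(1) M(1) by (simp add: field_simps)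
      finally have "1 + norm w \<le> (M / \<delta> + 1) * norm (w - s)" by (simp add: algebra_simps)
      moreover have "0 < 1 + norm w" by (simp add: add_pos_nonneg)
      ultimately have "ln (1 + norm w) \<le> ln ((M / \<delta> + 1) * norm (w - s))"
        by (subst ln_le_cancel_iff) auto
      also have "\<dots> = ln (M / \<delta> + 1) + ln (norm (w - s))"
        using pos d \<delta>(1) by (subst ln_mult) auto
      finally show ?thesis using C(1) by simp
    qed
    thus "\<exists>s\<^sub>0\<in>S. \<forall>s\<in>S - {s\<^sub>0}. ln (1 + norm w) - C \<le> ln (norm (w - s))" using s0(1) by blast
  next
    fix w s :: complex
    assume s: "s \<in> S \<union> T" "w \<noteq> s"
    have pos1: "1 + norm w > 0" by (rule add_pos_nonneg) auto
    have "norm (w - s) \<le> norm w + (M - 1)" using norm_triangle_ineq4[of w s] M(2)[OF s(1)] by simp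
    also have "\<dots> \<le> M * (1 + norm w)" using M(1) mult_right_mono[of 1 M "norm w"] by (simp add: algebra_simps)
    finally have "ln (norm (w - s)) \<le> ln (M * (1 + norm w))"
      using s(2) M(1) pos1 by (subst ln_le_cancel_iff) auto
    also have "\<dots> = ln M + ln (1 + norm w)" using M(1) pos1 by (subst ln_mult) auto
    finally show "ln (norm (w - s)) \<le> ln (1 + norm w) + C" using C(2) by simp
  qed
qed

text \<open>The bound with 3 is shared by the meromorphic and the entire statement. The stronger
  bound with 7 is requested only at points where a function has a pole, so that one argument serves
  both.\<close>

locale simple_roots =
  fixes P :: "complex poly" and S :: "complex set" and c :: complex
  assumes finite_S: "finite S" and c_nonzero: "c \<noteq> 0"
    and P_eq: "P = smult c (\<Prod>s\<in>S. [:- s, 1:])"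
    and card_S: "card S \<ge> 2 * card {z. poly (pderiv P) z = 0} + 3"
begin

definition "Z = {z. poly (pderiv P) z = 0}"
definition "n = card S"
definition "k = card Z"

text \<open>
  The exponents are perturbations of the limiting values 2, 2 and 1, for which the orders below would
  only be non-negative. The size of \<open>\<epsilon>\<close> is chosen such that \<open>\<epsilon>\<close>, \<open>n \<epsilon>\<close> and \<open>n k \<epsilon>\<close> are all negligible.
\<close>

definition \<epsilon> :: real where "\<epsilon> = 1 / (100 * (real n)\<^sup>2)"
definition expD :: real where "expD = 2 + 2 * \<epsilon>"
definition expB :: real where "expB = 2 + 2 * real n * \<epsilon>"
definition expP :: real where "expP = 1 - 2 * \<epsilon>"

lemma n_ge: "n \<ge> 2 * k + 3"
  using card_S by (simp add: n_def k_def Z_def)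

lemma S_nonempty: "S \<noteq> {}"
  using n_ge by (auto simp: n_def)

lemma eps_bounds:
  "\<epsilon> > 0" "\<epsilon> \<le> 1/100" "real n * \<epsilon> \<le> 1/100" "real n * real k * \<epsilon> \<le> 1/100" "real k * \<epsilon> \<le> 1/100"
proof -
  have n: "real n \<ge> 1" "real k \<le> real n" using n_ge by auto
  show eps: "\<epsilon> > 0" using n by (simp add: \<epsilon>_def)
  have nn: "real n * real n * \<epsilon> = 1/100" using n by (simp add: \<epsilon>_def power2_eq_square)
  have "real n * real k \<le> real n * real n" using n by (intro mult_left_mono) auto
  thus nk: "real n * real k * \<epsilon> \<le> 1/100" using eps nn mult_right_mono[of _ _ \<epsilon>] by fastforce
  have "real n * 1 \<le> real n * real n" using n by (intro mult_left_mono) auto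
  thus n1: "real n * \<epsilon> \<le> 1/100" using eps nn mult_right_mono[of _ _ \<epsilon>] by fastforce
  show "\<epsilon> \<le> 1/100" using n1 n(1) eps mult_right_mono[of 1 "real n" \<epsilon>] by linarith
  show "real k * \<epsilon> \<le> 1/100" using n1 n(2) eps mult_right_mono[of "real k" "real n" \<epsilon>] by linarith
qed

lemma poly_P: "poly P w = c * (\<Prod>s\<in>S. w - s)"
  by (simp add: P_eq poly_prod)

lemma poly_P_eq_0_iff: "poly P w = 0 \<longleftrightarrow> w \<in> S"
  using finite_S c_nonzero by (simp add: poly_P)

lemma degree_P: "degree P = n"
  using c_nonzero by (simp add: P_eq degree_prod_eq_sum_degree n_def)

lemma pderiv_P_nonzero: "pderiv P \<noteq> 0"
  using degree_P n_ge by (simp add: pderiv_eq_0_iff)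

lemma finite_Z: "finite Z"
  unfolding Z_def by (rule poly_roots_finite[OF pderiv_P_nonzero])

lemma rsquarefree_P: "w \<in> S \<Longrightarrow> w \<notin> Z"
proof -
  assume w: "w \<in> S"
  define Q where "Q = smult c (\<Prod>s\<in>S - {w}. [:- s, 1:])"
  have "P = [:- w, 1:] * Q"
    unfolding P_eq Q_def using prod.remove[OF finite_S w, of "\<lambda>s. [:- s, 1:]"]
    by (simp only: mult_smult_right)
  hence "pderiv P = [:- w, 1:] * pderiv Q + Q * pderiv [:- w, 1:]"
    by (simp only: pderiv_mult)
  hence "poly (pderiv P) w = poly Q w"
    by (simp add: pderiv_pCons)
  also have "\<dots> \<noteq> 0" using finite_S c_nonzero by (simp add: Q_def poly_prod)
  finally show ?thesis by (simp add: Z_def)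
qed

definition mlt :: "complex \<Rightarrow> nat" where "mlt \<beta> = order \<beta> (pderiv P)"

lemma poly_pderiv_P: "poly (pderiv P) w = lead_coeff (pderiv P) * (\<Prod>\<beta>\<in>Z. (w - \<beta>) ^ mlt \<beta>)"
proof -
  have "pderiv P = smult (lead_coeff (pderiv P)) (\<Prod>\<beta>\<in>Z. [:- \<beta>, 1:] ^ mlt \<beta>)"
    using complex_poly_decompose[of "pderiv P"] by (simp add: Z_def mlt_def)
  hence "poly (pderiv P) w = poly (smult (lead_coeff (pderiv P)) (\<Prod>\<beta>\<in>Z. [:- \<beta>, 1:] ^ mlt \<beta>)) w"
    by (rule arg_cong)
  thus ?thesis by (simp add: poly_prod)
qed

lemma mlt_le: "\<beta> \<in> Z \<Longrightarrow> mlt \<beta> \<le> n"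
  using order_degree[OF pderiv_P_nonzero, of \<beta>] degree_P by (simp add: mlt_def degree_pderiv)

text \<open>Counting each zero of \<open>P'\<close> once is what lets \<open>k\<close>, and not the
  degree \<open>n - 1\<close>, enter the exponents at poles and at infinity.\<close>

definition B :: "complex \<Rightarrow> complex" where "B w = (\<Prod>\<beta>\<in>Z. w - \<beta>)"

text \<open>The part of the metric that depends on the value \<open>w = f z\<close> alone.\<close>

definition weight :: "complex \<Rightarrow> real" where
  "weight w = norm (B w) powr expB * norm (poly P w) powr (- expP) * (\<Prod>s\<in>S. cpow \<epsilon> (w - s))"

text \<open>Up to the factor \<open>4 \<epsilon>\<^sup>2\<close> this is, off \<open>S\<close>, the
  Laplacian of the logarithm of the product of the \<open>cpow\<close> factors in
  \<open>weight\<close>. It has size \<open>|w - s| powr (2 \<epsilon> - 2)\<close> near a root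
  \<open>s\<close> and \<open>|w| powr (- 2 - 2 \<epsilon>)\<close> at infinity.\<close>

definition density :: "complex \<Rightarrow> real" where
  "density w = (\<Sum>s\<in>S. (1 / (norm (w - s) * cpow \<epsilon> (w - s)))\<^sup>2)"

lemma density_pos:
  assumes "w \<notin> S"
  shows "density w > 0"
  unfolding density_def
proof (intro sum_pos finite_S S_nonempty)
  fix s assume "s \<in> S"
  hence "w - s \<noteq> 0" using assms by auto
  thus "(1 / (norm (w - s) * cpow \<epsilon> (w - s)))\<^sup>2 > 0" using cpow_pos[of "w - s" \<epsilon>] by simp
qed

text \<open>
  Read with \<open>X = ln (1 + |w|)\<close> and \<open>Y\<close> the logarithm of the distance from \<open>w\<close> to the nearest root; the
  coefficient of \<open>Y\<close> is about 1 and that of \<open>X\<close> about \<open>2 k + 1 - n \<le> - 2\<close>.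
\<close>

lemma weight_exponent_ineq:
  assumes Y: "Y \<le> X + C" and "X \<ge> 0" "C \<ge> 0" and \<tau>: "\<bar>\<tau>\<bar> \<le> 3 * \<epsilon>"
  shows "(expB + 3 * real n * \<epsilon>) * real k * X - (expP + 2 * \<tau>) * (Y + (real n - 1) * X)
           + \<epsilon> * ((real n + 1) * X - Y)
         \<le> (expD + \<tau>) * (- (1 - \<epsilon>) * Y - 2 * \<epsilon> * X) + 2 * C"
proof -
  define \<theta> where "\<theta> = (expD + \<tau>) * (1 - \<epsilon>) - (expP + 2 * \<tau>) - \<epsilon>"
  have sq: "\<epsilon> * \<epsilon> \<le> \<epsilon> * (1/100)" "0 \<le> \<epsilon> * \<epsilon>" using eps_bounds(1,2) by (auto intro!: mult_left_mono)
  have "\<bar>\<epsilon> * \<tau>\<bar> = \<epsilon> * \<bar>\<tau>\<bar>" using eps_bounds(1) by (simp add: abs_mult)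
  also have "\<dots> \<le> \<epsilon> * (3 * \<epsilon>)" using \<tau> eps_bounds(1) by (intro mult_left_mono) auto
  finally have et: "\<bar>\<epsilon> * \<tau>\<bar> \<le> 3 * (\<epsilon> * \<epsilon>)" by simp
  have n1: "real n - 1 \<ge> 0" using n_ge by simp
  have "\<bar>\<tau> * (real n - 1)\<bar> = \<bar>\<tau>\<bar> * (real n - 1)" using n1 by (simp add: abs_mult)
  also have "\<dots> \<le> 3 * \<epsilon> * (real n - 1)" using \<tau> n1 by (intro mult_right_mono) auto
  finally have tn: "\<bar>\<tau> * (real n - 1)\<bar> \<le> 3 * (real n * \<epsilon>)"
    using eps_bounds(1) by (simp add: algebra_simps)
  have nk: "real n \<ge> 2 * real k + 3" using n_ge by linarith
  have \<theta>: "0 \<le> \<theta>" "\<theta> \<le> 2" "\<theta> \<le> 11/10"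
  proof -
    have "\<theta> = 1 + \<epsilon> - \<tau> - 2 * (\<epsilon> * \<epsilon>) - \<epsilon> * \<tau>"
      unfolding \<theta>_def expD_def expP_def by (simp add: algebra_simps)
    thus "0 \<le> \<theta>" "\<theta> \<le> 2" "\<theta> \<le> 11/10" using sq et \<tau> eps_bounds(1,2) by linarith+
  qed
  define \<xi> where "\<xi> = (expB + 3 * real n * \<epsilon>) * real k - (expP + 2 * \<tau>) * (real n - 1)
      + \<epsilon> * (real n + 1) + 2 * \<epsilon> * (expD + \<tau>)"
  have "\<xi> = 2 * real k - (real n - 1) + 5 * (real n * real k * \<epsilon>) + 3 * (real n * \<epsilon>) - 2 * (\<tau> * (real n - 1))
      + 3 * \<epsilon> + 4 * (\<epsilon> * \<epsilon>) + 2 * (\<epsilon> * \<tau>)"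
    unfolding \<xi>_def expB_def expP_def expD_def by (simp add: algebra_simps)
  hence "\<theta> + \<xi> \<le> 0"
    using \<theta>(3) sq et tn nk eps_bounds by linarith
  \<comment> \<open>Since \<open>\<theta>\<close> is non-negative, \<open>Y\<close> may be traded
    for \<open>X + C\<close>. The total coefficient of \<open>X\<close> is then about
    \<open>2 k + 2 - n\<close>, at most -1, and this margin absorbs the terms with
    \<epsilon>.\<close>
  have "\<theta> * Y \<le> \<theta> * (X + C)" using \<theta>(1) Y by (intro mult_left_mono)
  also have "\<dots> \<le> \<theta> * X + 2 * C" using \<theta>(2) \<open>C \<ge> 0\<close> by (simp add: distrib_left mult_right_mono)
  finally have "\<theta> * Y + \<xi> * X \<le> (\<theta> + \<xi>) * X + 2 * C" by (simp add: algebra_simps)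
  also have "\<dots> \<le> 2 * C" using \<open>\<theta> + \<xi> \<le> 0\<close> \<open>X \<ge> 0\<close> by (simp add: mult_nonpos_nonneg)
  finally show ?thesis unfolding \<theta>_def \<xi>_def by (simp add: algebra_simps)
qed

text \<open>After taking logarithms every factor is linear, up to bounded errors, in
  \<open>X\<close> and \<open>Y\<close>, because all roots but the nearest contribute
  \<open>X\<close>. The parameter \<open>\<tau>\<close> makes room for small powers of
  \<open>|A f|\<close>, and the exponent on the right is the one that
  \<open>|f'| powr (expD + \<tau>)\<close> will require.\<close>

lemma weight_le_density:
  obtains K where "K > 0" "\<And>w \<tau>. w \<notin> S \<Longrightarrow> w \<notin> Z \<Longrightarrow> \<bar>\<tau>\<bar> \<le> 3 * \<epsilon> \<Longrightarrow>
    weight w * (norm (poly (pderiv P) w) / (norm (poly P w))\<^sup>2) powr \<tau> \<le> K * density w powr ((expD + \<tau>) / 2)"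
proof -
  obtain C where C: "C \<ge> 0"
    "\<And>w. \<exists>s\<^sub>0\<in>S. \<forall>s\<in>S - {s\<^sub>0}. ln (1 + norm w) - C \<le> ln (norm (w - s))"
    "\<And>w s. s \<in> S \<union> Z \<Longrightarrow> w \<noteq> s \<Longrightarrow> ln (norm (w - s)) \<le> ln (1 + norm w) + C"
    using ln_norm_diff_bounds[OF finite_S S_nonempty finite_Z] by metis
  define l where "l = lead_coeff (pderiv P)"
  have "l \<noteq> 0" using pderiv_P_nonzero by (simp add: l_def)
  \<comment> \<open>The bounded errors of \<open>lB\<close>, \<open>e2\<close>, \<open>lC\<close>,
    \<open>e3\<close> and of the exponent inequality, added up.\<close>
  define D where "D = (expB + 3 * real n * \<epsilon>) * (real k * C) + \<bar>ln (norm l)\<bar>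
     + 2 * (\<bar>ln (norm c)\<bar> + real n * C) + real n * ln 2 + \<epsilon> * ((real n + 1) * C)
     + 2 * C + 3 * (ln 2 + 2 * \<epsilon> * C)"
  have "weight w * (norm (poly (pderiv P) w) / (norm (poly P w))\<^sup>2) powr \<tau> \<le> exp D * density w powr ((expD + \<tau>) / 2)"
    if w: "w \<notin> S" "w \<notin> Z" and \<tau>: "\<bar>\<tau>\<bar> \<le> 3 * \<epsilon>" for w \<tau>
  proof -
    obtain s\<^sub>0 where s0: "s\<^sub>0 \<in> S" "\<And>s. s \<in> S - {s\<^sub>0} \<Longrightarrow> ln (1 + norm w) - C \<le> ln (norm (w - s))"
      using C(2)[of w] by blast
    define X where "X = ln (1 + norm w)"
    define Y where "Y = ln (norm (w - s\<^sub>0))"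
    have "X \<ge> 0" unfolding X_def by simp
    have up: "ln (norm (w - s)) \<le> X + C" if "s \<in> S \<union> Z" for s
    proof -
      have "w \<noteq> s" using w that by blast
      thus ?thesis using C(3)[OF that, of w] unfolding X_def by simp
    qed
    have Y: "Y \<le> X + C" unfolding Y_def using up s0(1) by blast
    have Pw: "poly P w \<noteq> 0" "poly (pderiv P) w \<noteq> 0"
      using w poly_P_eq_0_iff by (auto simp: Z_def)
    have near: "\<bar>ln (norm (w - s)) - X\<bar> \<le> C" if "s \<in> S - {s\<^sub>0}" for s
      using s0(2)[OF that] up[of s] that by (auto simp: X_def abs_le_iff)
    define lP where "lP = ln (norm (poly P w))"
    have lP: "\<bar>lP - Y - (real n - 1) * X\<bar> \<le> \<bar>ln (norm c)\<bar> + real n * C"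
    proof -
      have "lP = ln (norm c) + (\<Sum>s\<in>S. ln (norm (w - s)))"
        unfolding lP_def poly_P norm_mult
        using w c_nonzero finite_S ln_norm_prod_diff[OF finite_S w(1), of "\<lambda>_. 1"]
        by (subst ln_mult) auto
      also have "(\<Sum>s\<in>S. ln (norm (w - s))) = Y + (\<Sum>s\<in>S - {s\<^sub>0}. ln (norm (w - s)))"
        unfolding Y_def by (rule sum.remove[OF finite_S s0(1)])
      also have "(\<Sum>s\<in>S - {s\<^sub>0}. ln (norm (w - s))) = (real n - 1) * X + (\<Sum>s\<in>S - {s\<^sub>0}. ln (norm (w - s)) - X)"
        using s0(1) finite_S n_ge by (simp add: sum_subtractf n_def of_nat_diff)
      finally have "lP - Y - (real n - 1) * X = ln (norm c) + (\<Sum>s\<in>S - {s\<^sub>0}. ln (norm (w - s)) - X)" by simp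
      moreover have "\<bar>\<Sum>s\<in>S - {s\<^sub>0}. ln (norm (w - s)) - X\<bar> \<le> (\<Sum>s\<in>S - {s\<^sub>0}. C)"
        by (intro order_trans[OF sum_abs] sum_mono near)
      moreover have "(\<Sum>s\<in>S - {s\<^sub>0}. C) \<le> real n * C"
        using C(1) finite_S s0(1) by (simp add: n_def mult_right_mono card_Diff_subset)
      ultimately show ?thesis by linarith
    qed
    have lB: "expB * ln (norm (B w)) + \<tau> * ln (norm (poly (pderiv P) w))
        \<le> (expB + 3 * real n * \<epsilon>) * (real k * (X + C)) + \<bar>ln (norm l)\<bar>"
    proof -
      have 1: "ln (norm (B w)) = (\<Sum>\<beta>\<in>Z. ln (norm (w - \<beta>)))"
        unfolding B_def using ln_norm_prod_diff[OF finite_Z w(2), of "\<lambda>_. 1"] by simp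
      have 2: "ln (norm (poly (pderiv P) w)) = ln (norm l) + (\<Sum>\<beta>\<in>Z. real (mlt \<beta>) * ln (norm (w - \<beta>)))"
        unfolding poly_pderiv_P l_def[symmetric] norm_mult
        using w finite_Z \<open>l \<noteq> 0\<close> ln_norm_prod_diff[OF finite_Z w(2), of mlt]
        by (subst ln_mult) auto
      have t1: "\<bar>\<tau>\<bar> \<le> 1" using \<tau> eps_bounds by linarith
      have "\<tau> * ln (norm l) \<le> \<bar>\<tau>\<bar> * \<bar>ln (norm l)\<bar>" by (metis abs_ge_self abs_mult)
      also have "\<dots> \<le> \<bar>ln (norm l)\<bar>" using t1 by (simp add: mult_left_le_one_le)
      finally have 3: "\<tau> * ln (norm l) \<le> \<bar>ln (norm l)\<bar>" .
      have "(\<Sum>\<beta>\<in>Z. (expB + \<tau> * real (mlt \<beta>)) * ln (norm (w - \<beta>)))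
          \<le> (\<Sum>\<beta>\<in>Z. (expB + 3 * real n * \<epsilon>) * (X + C))"
      proof (rule sum_mono)
        fix \<beta> assume \<beta>: "\<beta> \<in> Z"
        have "\<bar>\<tau> * real (mlt \<beta>)\<bar> \<le> 3 * \<epsilon> * real n"
          unfolding abs_mult using \<tau> mlt_le[OF \<beta>] eps_bounds(1) by (intro mult_mono) auto
        hence "0 \<le> expB + \<tau> * real (mlt \<beta>)" "expB + \<tau> * real (mlt \<beta>) \<le> expB + 3 * real n * \<epsilon>"
          using eps_bounds unfolding expB_def by (auto simp: abs_le_iff algebra_simps)
        thus "(expB + \<tau> * real (mlt \<beta>)) * ln (norm (w - \<beta>)) \<le> (expB + 3 * real n * \<epsilon>) * (X + C)"
          using up[of \<beta>] \<beta> \<open>X \<ge> 0\<close> C(1)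
          by (meson UnI2 add_nonneg_nonneg mult_left_mono mult_right_mono order_trans)
      qed
      thus ?thesis unfolding 1 2 using 3
        by (simp add: algebra_simps sum.distrib sum_distrib_left k_def)
    qed
    have cp0: "ln (cpow \<epsilon> (w - s\<^sub>0)) \<le> ln 2 + \<epsilon> * (2 * X + 2 * C - Y)"
    proof -
      \<comment> \<open>\<open>Y\<close> is bounded above by \<open>X + C\<close> but may be very
        negative, so its absolute value is replaced by a bound that is linear in
        \<open>Y\<close>.\<close>
      have "\<bar>Y\<bar> \<le> 2 * X + 2 * C - Y" using Y \<open>X \<ge> 0\<close> C(1) by linarith
      hence "\<epsilon> * \<bar>Y\<bar> \<le> \<epsilon> * (2 * X + 2 * C - Y)" using eps_bounds(1) by (intro mult_left_mono) auto
      moreover have "w - s\<^sub>0 \<noteq> 0" using w s0(1) by auto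
      hence "ln (cpow \<epsilon> (w - s\<^sub>0)) \<le> ln 2 + \<epsilon> * \<bar>Y\<bar>"
        unfolding Y_def using eps_bounds(1) by (rule ln_cpow_le)
      ultimately show ?thesis by linarith
    qed
    have lC: "ln (\<Prod>s\<in>S. cpow \<epsilon> (w - s)) \<le> real n * ln 2 + \<epsilon> * ((real n + 1) * (X + C) - Y)"
    proof -
      have "ln (\<Prod>s\<in>S. cpow \<epsilon> (w - s)) = (\<Sum>s\<in>S. ln (cpow \<epsilon> (w - s)))"
      proof (intro ln_prod finite_S)
        fix s assume "s \<in> S"
        hence "w - s \<noteq> 0" using w by auto
        from cpow_pos[OF this, of \<epsilon>] show "cpow \<epsilon> (w - s) \<noteq> 0" by simp
      qed
      also have "\<dots> = ln (cpow \<epsilon> (w - s\<^sub>0)) + (\<Sum>s\<in>S - {s\<^sub>0}. ln (cpow \<epsilon> (w - s)))"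
        by (rule sum.remove[OF finite_S s0(1)])
      also have "(\<Sum>s\<in>S - {s\<^sub>0}. ln (cpow \<epsilon> (w - s))) \<le> (\<Sum>s\<in>S - {s\<^sub>0}. ln 2 + \<epsilon> * (X + C))"
      proof (rule sum_mono)
        fix s assume s: "s \<in> S - {s\<^sub>0}"
        have "\<bar>ln (norm (w - s))\<bar> \<le> X + C" using near[OF s] \<open>X \<ge> 0\<close> by linarith
        hence "\<epsilon> * \<bar>ln (norm (w - s))\<bar> \<le> \<epsilon> * (X + C)" using eps_bounds(1) by (intro mult_left_mono) auto
        moreover have "w - s \<noteq> 0" using w s by auto
        hence "ln (cpow \<epsilon> (w - s)) \<le> ln 2 + \<epsilon> * \<bar>ln (norm (w - s))\<bar>"
          using eps_bounds(1) by (rule ln_cpow_le)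
        ultimately show "ln (cpow \<epsilon> (w - s)) \<le> ln 2 + \<epsilon> * (X + C)" by linarith
      qed
      also have "(\<Sum>s\<in>S - {s\<^sub>0}. ln 2 + \<epsilon> * (X + C)) = (real n - 1) * (ln 2 + \<epsilon> * (X + C))"
        using finite_S s0(1) n_ge by (simp add: n_def of_nat_diff)
      finally show ?thesis using cp0 by (simp add: algebra_simps)
    qed
    have dens: "density w > 0" by (rule density_pos) fact
    have ld: "- (1 - \<epsilon>) * Y - 2 * \<epsilon> * X - (ln 2 + 2 * \<epsilon> * C) \<le> ln (density w) / 2"
    proof -
      have w0: "w - s\<^sub>0 \<noteq> 0" using w s0(1) by auto
      have "(1 / (norm (w - s\<^sub>0) * cpow \<epsilon> (w - s\<^sub>0)))\<^sup>2 \<le> density w"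
        unfolding density_def by (rule member_le_sum[OF s0(1) _ finite_S]) auto
      hence "ln ((1 / (norm (w - s\<^sub>0) * cpow \<epsilon> (w - s\<^sub>0)))\<^sup>2) \<le> ln (density w)"
        using dens w0 cpow_pos[OF w0, of \<epsilon>] by (subst ln_le_cancel_iff) auto
      also have "ln ((1 / (norm (w - s\<^sub>0) * cpow \<epsilon> (w - s\<^sub>0)))\<^sup>2) = 2 * (- Y - ln (cpow \<epsilon> (w - s\<^sub>0)))"
        using w0 cpow_pos[OF w0, of \<epsilon>] by (simp add: Y_def ln_realpow ln_div ln_mult)
      finally show ?thesis using cp0 by (simp add: algebra_simps)
    qed
    define LHS where "LHS = weight w * (norm (poly (pderiv P) w) / (norm (poly P w))\<^sup>2) powr \<tau>"
    have Bw: "B w \<noteq> 0" using w finite_Z by (auto simp: B_def)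
    have Cw: "(\<Prod>s\<in>S. cpow \<epsilon> (w - s)) > 0" using w by (intro prod_pos cpow_pos) auto
    have LHSpos: "LHS > 0" unfolding LHS_def weight_def using Bw Cw Pw by simp
    have "ln LHS = expB * ln (norm (B w)) + (- expP) * lP + ln (\<Prod>s\<in>S. cpow \<epsilon> (w - s))
        + \<tau> * (ln (norm (poly (pderiv P) w)) - 2 * lP)"
      unfolding LHS_def weight_def lP_def using Bw Cw Pw
      by (simp add: ln_mult ln_div ln_realpow)
    hence e1: "ln LHS = (expB * ln (norm (B w)) + \<tau> * ln (norm (poly (pderiv P) w)))
       - (expP + 2 * \<tau>) * lP + ln (\<Prod>s\<in>S. cpow \<epsilon> (w - s))"
      by (simp add: algebra_simps)
    have pt: "0 \<le> expP + 2 * \<tau>" "expP + 2 * \<tau> \<le> 2" "0 \<le> expD + \<tau>" "expD + \<tau> \<le> 3"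
      using \<tau> eps_bounds unfolding expP_def expD_def by (auto simp: abs_le_iff)
    have e2: "(expP + 2 * \<tau>) * (Y + (real n - 1) * X) - 2 * (\<bar>ln (norm c)\<bar> + real n * C) \<le> (expP + 2 * \<tau>) * lP"
    proof -
      have "(expP + 2 * \<tau>) * (Y + (real n - 1) * X - (\<bar>ln (norm c)\<bar> + real n * C)) \<le> (expP + 2 * \<tau>) * lP"
        using lP pt(1) by (intro mult_left_mono) (auto simp: abs_le_iff)
      moreover have "(expP + 2 * \<tau>) * (\<bar>ln (norm c)\<bar> + real n * C) \<le> 2 * (\<bar>ln (norm c)\<bar> + real n * C)"
        using pt(2) C(1) by (intro mult_right_mono) auto
      ultimately show ?thesis by (simp add: right_diff_distrib)
    qed
    have e3: "(expD + \<tau>) * (- (1 - \<epsilon>) * Y - 2 * \<epsilon> * X) - 3 * (ln 2 + 2 * \<epsilon> * C) \<le> (expD + \<tau>) / 2 * ln (density w)"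
    proof -
      have "(expD + \<tau>) * (- (1 - \<epsilon>) * Y - 2 * \<epsilon> * X - (ln 2 + 2 * \<epsilon> * C)) \<le> (expD + \<tau>) * (ln (density w) / 2)"
        using ld pt(3) by (rule mult_left_mono)
      moreover have "(expD + \<tau>) * (ln 2 + 2 * \<epsilon> * C) \<le> 3 * (ln 2 + 2 * \<epsilon> * C)"
        using pt(4) C(1) eps_bounds(1) by (intro mult_right_mono) auto
      ultimately show ?thesis by (simp add: right_diff_distrib)
    qed
    have e4: "(expB + 3 * real n * \<epsilon>) * (real k * (X + C)) = (expB + 3 * real n * \<epsilon>) * real k * X + (expB + 3 * real n * \<epsilon>) * (real k * C)"
      by (simp add: algebra_simps)
    have e5: "\<epsilon> * ((real n + 1) * (X + C) - Y) = \<epsilon> * ((real n + 1) * X - Y) + \<epsilon> * ((real n + 1) * C)"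
      by (simp add: algebra_simps)
    have "ln LHS \<le> D + (expD + \<tau>) / 2 * ln (density w)"
      using weight_exponent_ineq[OF Y \<open>X \<ge> 0\<close> C(1) \<tau>] lB lC e1 e2 e3 unfolding D_def e4 e5 by linarith
    hence "exp (ln LHS) \<le> exp (D + (expD + \<tau>) / 2 * ln (density w))" by simp
    thus ?thesis using LHSpos dens unfolding LHS_def by (simp add: exp_add powr_def)
  qed
  thus ?thesis by (intro that[of "exp D"]) auto
qed

end

section \<open>Local behaviour of the factors of the metric\<close>

lemma has_ord_0_imp_nonzero:
  assumes "has_ord h z 0" "h analytic_on {z}"
  shows "h z \<noteq> 0"
proof -
  obtain \<phi> where \<phi>: "\<phi> analytic_on {z}" "\<phi> z \<noteq> 0" "\<forall>\<^sub>F w in at z. h w = \<phi> w * (w - z) powi 0"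
    using assms(1) by (rule has_ordE)
  have lim: "(\<phi> \<longlongrightarrow> \<phi> z) (at z)" "(h \<longlongrightarrow> h z) (at z)"
    using analytic_at_imp_isCont[OF \<phi>(1)] analytic_at_imp_isCont[OF assms(2)] by (simp_all add: isCont_def)
  have "\<forall>\<^sub>F w in at z. \<phi> w = h w" using \<phi>(3) by (auto elim: eventually_mono)
  from Lim_transform_eventually[OF lim(1) this] have "h z = \<phi> z"
    using lim(2) tendsto_unique[OF at_neq_bot] by blast
  thus ?thesis using \<phi>(2) by simp
qed

lemma analytic_bigo:
  assumes "h analytic_on {z}"
  shows "(\<lambda>w. norm (h w)) \<in> O[at z](\<lambda>w. norm (w - z) powr 0)"
    and "h z = 0 \<Longrightarrow> (\<lambda>w. norm (h w)) \<in> O[at z](\<lambda>w. norm (w - z) powr 1)"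
proof -
  have "(h \<longlongrightarrow> h z) (at z)"
    using analytic_at_imp_isCont[OF assms(1)] by (simp add: isCont_def)
  hence "\<forall>\<^sub>F w in at z. dist (h w) (h z) < 1" by (rule tendstoD) simp
  hence "\<forall>\<^sub>F w in at z. norm (norm (h w)) \<le> (1 + norm (h z)) * norm (norm (w - z) powr 0)"
    using eventually_at_neq
  proof eventually_elim
    case (elim w)
    have "norm (h w) \<le> norm (h w - h z) + norm (h z)"
      using norm_triangle_ineq[of "h w - h z" "h z"] by simp
    thus ?case using elim by (simp add: dist_norm)
  qed
  thus "(\<lambda>w. norm (h w)) \<in> O[at z](\<lambda>w. norm (w - z) powr 0)" by (rule bigoI)
  assume hz: "h z = 0"
  have "(h has_field_derivative deriv h z) (at z)"
    using assms by (simp add: analytic_on_imp_differentiable_at DERIV_deriv_iff_field_differentiable)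
  hence "((\<lambda>w. (h w - h z) / (w - z)) \<longlongrightarrow> deriv h z) (at z)"
    by (simp add: has_field_derivative_iff)
  hence "\<forall>\<^sub>F w in at z. dist (h w / (w - z)) (deriv h z) < 1"
    using hz by (intro tendstoD) auto
  hence "\<forall>\<^sub>F w in at z. norm (norm (h w)) \<le> (1 + norm (deriv h z)) * norm (norm (w - z) powr 1)"
    using eventually_at_neq
  proof eventually_elim
    case (elim w)
    have "norm (h w / (w - z)) \<le> norm (h w / (w - z) - deriv h z) + norm (deriv h z)"
      using norm_triangle_ineq[of "h w / (w - z) - deriv h z" "deriv h z"] by simp
    hence "norm (h w / (w - z)) \<le> 1 + norm (deriv h z)" using elim by (simp add: dist_norm)
    thus ?case using elim by (simp add: norm_divide divide_simps split: if_splits)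
  qed
  thus "(\<lambda>w. norm (h w)) \<in> O[at z](\<lambda>w. norm (w - z) powr 1)" by (rule bigoI)
qed

context simple_roots
begin

definition A :: "(complex \<Rightarrow> complex) \<Rightarrow> complex \<Rightarrow> complex" where
  "A f z = deriv f z * poly (pderiv P) (f z) / (poly P (f z))\<^sup>2"

definition N :: "(complex \<Rightarrow> complex) \<Rightarrow> complex \<Rightarrow> real" where
  "N f z = norm (deriv f z) powr expD * weight (f z)"

text \<open>At such points all factors of \<open>N f\<close> are finite and positive, and
  \<open>A f\<close> is analytic and nonzero.\<close>

definition regular :: "(complex \<Rightarrow> complex) \<Rightarrow> complex \<Rightarrow> bool" where
  "regular f z \<longleftrightarrow> f analytic_on {z} \<and> deriv f z \<noteq> 0 \<and> f z \<notin> S \<and> f z \<notin> Z"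

lemma weight_pos: "w \<notin> S \<Longrightarrow> w \<notin> Z \<Longrightarrow> weight w > 0"
  unfolding weight_def
  by (intro mult_pos_pos prod_pos cpow_pos) (auto simp: poly_P_eq_0_iff B_def finite_Z)

section \<open>Orders of \<open>A f\<close> and \<open>N f\<close> in terms of those of
  \<open>f - a\<close>\<close>

lemma poly_P_order:
  assumes "\<And>a. has_ord (\<lambda>w. f w - a) z (r a)"
  shows "has_ord (\<lambda>w. poly P (f w)) z (\<Sum>s\<in>S. r s)"
proof -
  have "has_ord (\<lambda>w. c * (\<Prod>s\<in>S. f w - s)) z (0 + (\<Sum>s\<in>S. r s))"
    by (intro has_ord_mult has_ord_const has_ord_prod assms c_nonzero finite_S)
  thus ?thesis by (simp add: poly_P)
qed

lemma A_order:
  assumes "\<And>a. has_ord (\<lambda>w. f w - a) z (r a)" "has_ord (deriv f) z d"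
  shows "has_ord (A f) z (d + (\<Sum>\<beta>\<in>Z. int (mlt \<beta>) * r \<beta>) - 2 * (\<Sum>s\<in>S. r s))"
proof -
  have "has_ord (\<lambda>w. lead_coeff (pderiv P) * (\<Prod>\<beta>\<in>Z. (f w - \<beta>) ^ mlt \<beta>)) z
          (0 + (\<Sum>\<beta>\<in>Z. int (mlt \<beta>) * r \<beta>))"
    using pderiv_P_nonzero
    by (intro has_ord_mult has_ord_const has_ord_prod has_ord_power assms finite_Z) auto
  hence 1: "has_ord (\<lambda>w. poly (pderiv P) (f w)) z (\<Sum>\<beta>\<in>Z. int (mlt \<beta>) * r \<beta>)"
    by (simp add: poly_pderiv_P)
  have "has_ord (\<lambda>w. deriv f w * poly (pderiv P) (f w) / (poly P (f w))\<^sup>2) z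
     (d + (\<Sum>\<beta>\<in>Z. int (mlt \<beta>) * r \<beta>) - int 2 * (\<Sum>s\<in>S. r s))"
    by (intro has_ord_divide has_ord_mult has_ord_power assms poly_P_order 1)
  thus ?thesis by (simp add: A_def[abs_def])
qed

lemma N_bigo:
  assumes "\<And>a. has_ord (\<lambda>w. f w - a) z (r a)" "has_ord (deriv f) z d"
  shows "N f \<in> O[at z](\<lambda>w. norm (w - z) powr (expD * of_int d + (expB * of_int (\<Sum>\<beta>\<in>Z. r \<beta>)
           - expP * of_int (\<Sum>s\<in>S. r s) + (\<Sum>s\<in>S. - \<epsilon> * \<bar>of_int (r s)\<bar>))))"
proof -
  have 1: "has_ord (\<lambda>w. B (f w)) z (\<Sum>\<beta>\<in>Z. r \<beta>)"
    unfolding B_def by (intro has_ord_prod assms finite_Z)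
  have "(\<lambda>w. norm (deriv f w) powr expD * (norm (B (f w)) powr expB * norm (poly P (f w)) powr (- expP) *
           (\<Prod>s\<in>S. cpow \<epsilon> (f w - s)))) \<in> O[at z](\<lambda>w. norm (w - z) powr (expD * of_int d + (expB * of_int (\<Sum>\<beta>\<in>Z. r \<beta>)
           + (- expP) * of_int (\<Sum>s\<in>S. r s) + (\<Sum>s\<in>S. - \<epsilon> * \<bar>of_int (r s)\<bar>))))"
    by (intro norm_powr_bigo_mult has_ord_powr_bigo norm_powr_bigo_prod has_ord_cpow_bigo
          poly_P_order 1 assms finite_S eps_bounds(1))
  thus ?thesis by (simp add: N_def[abs_def] weight_def)
qed

text \<open>As \<open>- 1 / P(f)\<close> has a pole of order \<open>m\<close>, its derivative
  \<open>A f\<close> has order \<open>- m - 1\<close>. Roots of \<open>P\<close> are not zeros of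
  \<open>P'\<close>, so in the limit only \<open>|f'|^2 / |P(f)|\<close> counts for
  \<open>N f\<close>, with exponent \<open>m - 2\<close>; the one singular \<open>cpow\<close>
  factor costs \<open>\<epsilon> m\<close>.\<close>

lemma local_at_root:
  assumes "nonconst_meromorphic f" "\<not> is_pole f z" "f z \<in> S"
  defines "m \<equiv> zorder (\<lambda>w. f w - f z) z"
  shows "m > 0" "has_ord (A f) z (- m - 1)"
    "N f \<in> O[at z](\<lambda>w. norm (w - z) powr (expD * (of_int m - 1) - (expP + \<epsilon>) * of_int m))"
    and "has_ord (\<lambda>w. poly P (f w)) z m"
proof -
  have *: "m > 0" "f analytic_on {z}" "\<And>a. has_ord (\<lambda>w. f w - a) z (if a = f z then m else 0)"
      "has_ord (deriv f) z (m - 1)"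
    using nonconst_meromorphic_local[OF assms(1), of z] assms(2) unfolding m_def[symmetric] by blast+
  show "m > 0" by fact
  have S: "(\<Sum>s\<in>S. if s = f z then m else 0) = m"
    using finite_S assms(3) by simp
  have S': "(\<Sum>s\<in>S. - \<epsilon> * \<bar>real_of_int (if s = f z then m else 0)\<bar>) = - \<epsilon> * of_int m"
  proof -
    have "(\<Sum>s\<in>S. - \<epsilon> * \<bar>real_of_int (if s = f z then m else 0)\<bar>) = (\<Sum>s\<in>S. if s = f z then - \<epsilon> * of_int m else 0)"
      using \<open>m > 0\<close> by (intro sum.cong) auto
    thus ?thesis using finite_S assms(3) by simp
  qed
  have Z: "\<beta> \<in> Z \<Longrightarrow> \<beta> \<noteq> f z" for \<beta> using rsquarefree_P[OF assms(3)] by auto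
  have Z1: "(\<Sum>\<beta>\<in>Z. int (mlt \<beta>) * (if \<beta> = f z then m else 0)) = 0"
    using Z by (intro sum.neutral) auto
  have Z2: "(\<Sum>\<beta>\<in>Z. if \<beta> = f z then m else 0) = 0"
    using Z by (intro sum.neutral) auto
  show "has_ord (A f) z (- m - 1)"
  proof -
    have "m - 1 + 0 - 2 * m = - m - 1" by simp
    thus ?thesis using A_order[OF *(3,4)] unfolding S Z1 by simp
  qed
  show "N f \<in> O[at z](\<lambda>w. norm (w - z) powr (expD * (of_int m - 1) - (expP + \<epsilon>) * of_int m))"
    using N_bigo[OF *(3,4)] unfolding S S' Z2 by (simp add: algebra_simps)
  show "has_ord (\<lambda>w. poly P (f w)) z m"
    using poly_P_order[OF *(3)] unfolding S .
qed

lemma sum_delta_Z: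
  assumes "b \<in> Z"
  shows "(\<Sum>\<beta>\<in>Z. int (mlt \<beta>) * (if \<beta> = b then m else 0)) = int (mlt b) * m"
    and "(\<Sum>\<beta>\<in>Z. if \<beta> = b then m else 0) = m"
  using assms finite_Z by (simp_all add: if_distrib[of "\<lambda>x. _ * x"] cong: if_cong)

text \<open>The threshold 2 pays for a simple pole of \<open>H\<close>, which enters the metric
  squared, and \<open>\<epsilon> |v|\<close> pays for \<open>cpow\<close> of
  \<open>A_f / A_g\<close>. In the limit the exponent is \<open>(n - 2 k - 2) q - 2 \<ge> 3\<close>
  at a pole, \<open>4 m - 2\<close> at a zero of \<open>B(f)\<close> and \<open>2 (m - 1)\<close> at
  another critical point. The last two can equal 2, so strictness there comes from the surpluses in
  \<open>expB\<close> and \<open>expD\<close>.\<close>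

lemma local_off_roots:
  assumes "nonconst_meromorphic f" "is_pole f z \<or> f z \<notin> S" "is_pole f z \<Longrightarrow> n \<ge> 2 * k + 7"
  obtains e v where "N f \<in> O[at z](\<lambda>w. norm (w - z) powr e)" "has_ord (A f) z v"
    "(regular f z \<and> e = 0 \<and> v = 0) \<or> e - \<epsilon> * \<bar>of_int v\<bar> > 2"
  using nonconst_meromorphic_local[OF assms(1), of z]
proof (elim disjE exE conjE)
  fix q :: int
  assume q: "q > 0" "is_pole f z" "\<forall>a. has_ord (\<lambda>w. f w - a) z (- q)" "has_ord (deriv f) z (- q - 1)"
  define M where "M = (\<Sum>\<beta>\<in>Z. int (mlt \<beta>))"
  have M: "0 \<le> M" "M \<le> int n * int k"
  proof -
    show "0 \<le> M" unfolding M_def by (intro sum_nonneg) auto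
    have "M \<le> (\<Sum>\<beta>\<in>Z. int n)" unfolding M_def using mlt_le by (intro sum_mono) auto
    thus "M \<le> int n * int k" by (simp add: k_def mult.commute)
  qed
  define v where "v = - q - 1 + M * (- q) - 2 * (int n * (- q))"
  define e where "e = expD * of_int (- q - 1) + (expB * of_int (int k * (- q)) - expP * of_int (int n * (- q)) + real n * (- \<epsilon> * of_int q))"
  have "has_ord (A f) z v"
    using A_order[of f z "\<lambda>_. - q" "- q - 1"] q unfolding sum_distrib_right[symmetric] v_def M_def
    by (simp add: n_def)
  moreover have "N f \<in> O[at z](\<lambda>w. norm (w - z) powr e)"
    using N_bigo[of f z "\<lambda>_. - q" "- q - 1"] q unfolding e_def by (simp add: n_def k_def)
  moreover have "e - \<epsilon> * \<bar>of_int v\<bar> > 2"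
  proof -
    define x where "x = real_of_int q"
    have x: "x \<ge> 1" using q(1) by (simp add: x_def)
    have n7: "real n \<ge> 2 * real k + 7" using assms(3)[OF q(2)] by linarith
    have "real_of_int M \<le> real_of_int (int n * int k)" "0 \<le> real_of_int M"
      using M by (simp_all only: of_int_le_iff of_int_0_le_iff)
    hence Mx: "real_of_int M * x \<le> real n * real k * x" "0 \<le> real_of_int M * x"
      using x by (auto intro!: mult_right_mono)
    have nx: "0 \<le> real n * x" using x by simp
    have "real_of_int v = - x - 1 - real_of_int M * x + 2 * (real n * x)"
      by (simp add: v_def x_def)
    hence "\<bar>real_of_int v\<bar> \<le> x + 1 + real n * real k * x + 2 * (real n * x)"
      using Mx x nx by linarith
    hence "\<epsilon> * \<bar>real_of_int v\<bar> \<le> \<epsilon> * (x + 1 + real n * real k * x + 2 * (real n * x))"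
      using eps_bounds(1) by (intro mult_left_mono) auto
    also have "\<dots> = x * (\<epsilon> + real n * real k * \<epsilon> + 2 * (real n * \<epsilon>)) + \<epsilon>" by (simp add: algebra_simps)
    finally have 1: "\<epsilon> * \<bar>real_of_int v\<bar> \<le> x * (\<epsilon> + real n * real k * \<epsilon> + 2 * (real n * \<epsilon>)) + \<epsilon>" .
    have 2: "e = x * (real n - 2 * real k - 2 - 2 * \<epsilon> - 3 * (real n * \<epsilon>) - 2 * (real n * real k * \<epsilon>)) - 2 - 2 * \<epsilon>"
      unfolding e_def expD_def expB_def expP_def by (simp add: x_def algebra_simps)
    define t where "t = real n - 2 * real k - 2 - 3 * \<epsilon> - 5 * (real n * \<epsilon>) - 3 * (real n * real k * \<epsilon>)"
    \<comment> \<open>The main part of \<open>t\<close> is at least 5. Any value above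
      \<open>4 + 3 \<epsilon>\<close> would leave more than 2 after subtracting the
      \<open>2 + 3 \<epsilon>\<close> that accompanies \<open>x * t\<close> below.\<close>
    have "t \<ge> 9/2" unfolding t_def using n7 eps_bounds by linarith
    hence "9/2 \<le> x * t" using x mult_mono[of 1 x "9/2" t] by simp
    also have "\<dots> \<le> e - \<epsilon> * \<bar>real_of_int v\<bar> + 2 + 3 * \<epsilon>"
      using 1 unfolding 2 t_def by (simp add: algebra_simps)
    finally show ?thesis using eps_bounds(2) by linarith
  qed
  ultimately show ?thesis using that by blast
next
  fix m :: int
  assume m: "m > 0" "\<not> is_pole f z" "f analytic_on {z}"
    "\<forall>a. has_ord (\<lambda>w. f w - a) z (if a = f z then m else 0)" "has_ord (deriv f) z (m - 1)"
  have fS: "f z \<notin> S" using assms(2) m(2) by blast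
  have S: "(\<Sum>s\<in>S. if s = f z then m else 0) = 0" 
    using fS by (intro sum.neutral) auto
  have S': "(\<Sum>s\<in>S. - \<epsilon> * \<bar>real_of_int (if s = f z then m else 0)\<bar>) = 0"
    using fS by (intro sum.neutral) auto
  define x where "x = real_of_int m"
  have x: "x \<ge> 1" using m(1) by (simp add: x_def)
  show ?thesis
  proof (cases "f z \<in> Z")
    case True
    define v where "v = m - 1 + int (mlt (f z)) * m"
    have "has_ord (A f) z v"
      using A_order[OF m(4)[rule_format] m(5)] unfolding S sum_delta_Z[OF True] v_def by simp
    moreover have "N f \<in> O[at z](\<lambda>w. norm (w - z) powr (expD * (x - 1) + expB * x))"
      using N_bigo[OF m(4)[rule_format] m(5)] unfolding S S' sum_delta_Z[OF True] x_def by simp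
    \<comment> \<open>At \<open>m = 1\<close> the order \<open>v\<close> equals
      \<open>mlt (f z)\<close>, bounded by \<open>n\<close>. The surplus
      \<open>2 n \<epsilon>\<close> in \<open>expB\<close> is twice what this can cost.\<close>
    moreover have "expD * (x - 1) + expB * x - \<epsilon> * \<bar>of_int v\<bar> > 2"
    proof -
      have "real (mlt (f z)) * x \<le> real n * x" "0 \<le> real (mlt (f z)) * x"
        using mlt_le[OF True] x by (auto intro!: mult_right_mono)
      hence "\<bar>real_of_int v\<bar> \<le> x - 1 + real n * x"
        using x unfolding v_def by (simp add: x_def)
      hence "\<epsilon> * \<bar>real_of_int v\<bar> \<le> \<epsilon> * (x - 1 + real n * x)"
        using eps_bounds(1) by (intro mult_left_mono) auto
      moreover have "expD * (x - 1) + expB * x - \<epsilon> * (x - 1 + real n * x)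
          = 2 + real n * \<epsilon> + (x - 1) * (4 + \<epsilon> + real n * \<epsilon>)"
        unfolding expD_def expB_def by (simp add: algebra_simps)
      moreover have "0 \<le> (x - 1) * (4 + \<epsilon> + real n * \<epsilon>)"
        using x eps_bounds(1) by (intro mult_nonneg_nonneg) auto
      moreover have "real n * \<epsilon> > 0" using n_ge eps_bounds(1) by simp
      ultimately show ?thesis by linarith
    qed
    ultimately show ?thesis using that by blast
  next
    case False
    have Z1: "(\<Sum>\<beta>\<in>Z. int (mlt \<beta>) * (if \<beta> = f z then m else 0)) = 0"
      using False by (intro sum.neutral) auto
    have Z2: "(\<Sum>\<beta>\<in>Z. if \<beta> = f z then m else 0) = 0"
      using False by (intro sum.neutral) auto
    have A: "has_ord (A f) z (m - 1)"
      using A_order[OF m(4)[rule_format] m(5)] unfolding S Z1 by simp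
    have Nf: "N f \<in> O[at z](\<lambda>w. norm (w - z) powr (expD * (x - 1)))"
      using N_bigo[OF m(4)[rule_format] m(5)] unfolding S S' Z2 x_def by simp
    have "regular f z" if "m = 1"
      using has_ord_0_imp_nonzero[of "deriv f" z] m that fS False
      by (auto simp: regular_def intro: analytic_deriv)
    moreover have "expD * (x - 1) - \<epsilon> * \<bar>of_int (m - 1)\<bar> > 2" if "m \<noteq> 1"
    proof -
      have "x - 1 \<ge> 1" using that m(1) by (simp add: x_def)
      hence "(2 + \<epsilon>) * (x - 1) \<ge> (2 + \<epsilon>) * 1" using eps_bounds(1) by (intro mult_left_mono) auto
      moreover have "2 < (2 + \<epsilon>) * 1" using eps_bounds(1) by simp
      ultimately have ge: "2 < (2 + \<epsilon>) * (x - 1)" by (rule less_le_trans[rotated])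
      have abs: "\<bar>real_of_int (m - 1)\<bar> = x - 1" using m(1) by (simp add: x_def)
      have eq: "expD * (x - 1) - \<epsilon> * (x - 1) = (2 + \<epsilon>) * (x - 1)"
        unfolding expD_def by (simp add: algebra_simps)
      show ?thesis unfolding abs eq by (rule ge)
    qed
    ultimately show ?thesis using that[OF Nf A] by (cases "m = 1") (auto simp: x_def)
  qed
qed

text \<open>
  At a simple root, \<open>A f\<close> is the derivative of a function with a simple pole, so it has no residue.
\<close>

lemma logderiv_simple_root:
  assumes "nonconst_meromorphic f" "\<not> is_pole f z" "f z \<in> S" "zorder (\<lambda>w. f w - f z) z = 1"
  obtains \<rho> where "\<rho> analytic_on {z}" "\<rho> z = 0"
    "\<forall>\<^sub>F w in at z. deriv (A f) w / A f w = - 2 / (w - z) + \<rho> w"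
proof -
  define F where "F = (\<lambda>w. poly P (f w))"
  have "has_ord F z 1" using local_at_root(4)[OF assms(1-3)] assms(4) by (simp add: F_def)
  then obtain \<phi> where \<phi>: "\<phi> analytic_on {z}" "\<phi> z \<noteq> 0" "\<forall>\<^sub>F w in at z. F w = \<phi> w * (w - z) powi 1"
    by (rule has_ordE)
  define G where "G = (\<lambda>w. deriv \<phi> w * (w - z) + \<phi> w)"
  define \<psi> where "\<psi> = (\<lambda>w. G w / (\<phi> w)\<^sup>2)"
  have G: "G analytic_on {z}" unfolding G_def by (intro analytic_intros \<phi>)
  have \<psi>: "\<psi> analytic_on {z}" "\<psi> z \<noteq> 0"
    unfolding \<psi>_def using \<phi>(2) by (auto intro!: analytic_intros \<phi> G simp: G_def)
  have der: "(h has_field_derivative deriv h z) (at z)" if "h analytic_on {z}" for h :: "complex \<Rightarrow> complex"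
    using that by (simp add: analytic_on_imp_differentiable_at DERIV_deriv_iff_field_differentiable)
  \<comment> \<open>Near \<open>z\<close> the function \<open>A f\<close> will be
    \<open>\<psi> / (w - z)\<^sup>2\<close>, with residue \<open>deriv \<psi> z\<close>. It vanishes
    since \<open>G\<close> and its derivative have the values \<open>\<phi> z\<close> and
    \<open>2 * deriv \<phi> z\<close> at \<open>z\<close>.\<close>
  have "deriv \<psi> z = 0"
  proof -
    have "(G has_field_derivative 2 * deriv \<phi> z) (at z)"
      unfolding G_def using der[OF analytic_deriv[OF \<phi>(1)]] der[OF \<phi>(1)]
      by (auto intro!: derivative_eq_intros)
    moreover have Gz: "G z = \<phi> z" by (simp add: G_def)
    ultimately have "(\<psi> has_field_derivative 0) (at z)"
      unfolding \<psi>_def using \<phi>(2)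
      by (auto intro!: derivative_eq_intros der[OF \<phi>(1)] simp: Gz power2_eq_square)
    thus ?thesis by (rule DERIV_imp_deriv)
  qed
  have "f analytic_on {z}"
    using nonconst_meromorphic_local[OF assms(1), of z] assms(2) by auto
  then obtain s where s: "open s" "z \<in> s" "f holomorphic_on s" using analytic_at by blast
  have "\<forall>\<^sub>F w in at z. w \<in> s" using s by (intro eventually_at_in_open') auto
  hence "\<forall>\<^sub>F w in at z. A f w = \<psi> w * (w - z) powi (- 2)"
    using has_ord_deriv_aux[OF \<phi>(1,3)] \<phi>(3) eventually_at_neq
  proof eventually_elim
    case (elim w)
    have "(f has_field_derivative deriv f w) (at w)" using s elim holomorphic_derivI by blast
    hence "(F has_field_derivative poly (pderiv P) (f w) * deriv f w) (at w)"
      unfolding F_def by (rule DERIV_chain2[OF poly_DERIV])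
    hence "deriv F w = poly (pderiv P) (f w) * deriv f w" by (rule DERIV_imp_deriv)
    hence "A f w = G w / (F w)\<^sup>2"
      using elim by (simp add: A_def F_def G_def mult.commute)
    also have "\<dots> = \<psi> w * (w - z) powi (- 2)"
      using elim by (simp add: \<psi>_def power_mult_distrib power_int_minus divide_simps)
    finally show ?case .
  qed
  from factored_logderiv[OF \<psi> this] show ?thesis
    using \<psi> \<open>deriv \<psi> z = 0\<close>
    by (intro that[of "\<lambda>w. deriv \<psi> w / \<psi> w"]) (auto intro!: analytic_intros)
qed

end

section \<open>The metric of a pair of functions\<close>

context simple_roots
begin

text \<open>\<open>\<eta> f - \<eta> g\<close> is the function \<open>H\<close>; splitting it lets
  each half be expanded with its own order.\<close>

definition \<eta> :: "(complex \<Rightarrow> complex) \<Rightarrow> complex \<Rightarrow> complex" where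
  "\<eta> f z = deriv (A f) z / A f z"

definition T :: "(complex \<Rightarrow> complex) \<Rightarrow> (complex \<Rightarrow> complex) \<Rightarrow> complex \<Rightarrow> real" where
  "T f g z = N f z * N g z * ((norm (\<eta> f z - \<eta> g z))\<^sup>2 * cpow \<epsilon> (A f z / A g z))"

text \<open>The value 0 overrides whatever the conventions for division and \<open>powr\<close> give
  at exceptional points. Continuity there then means that \<open>T\<close> tends to 0.\<close>

definition U :: "(complex \<Rightarrow> complex) \<Rightarrow> (complex \<Rightarrow> complex) \<Rightarrow> complex \<Rightarrow> real" where
  "U f g z = (if regular f z \<and> regular g z then T f g z else 0)"

text \<open>This is the multiplicity function of \<open>E_f(S)\<close>. Poles are excluded since
  their conventional value 0 may lie in \<open>S\<close>.\<close>

definition root_mult :: "(complex \<Rightarrow> complex) \<Rightarrow> complex \<Rightarrow> nat" where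
  "root_mult f z = (if \<not> is_pole f z \<and> f z \<in> S then nat (zorder (\<lambda>w. f w - f z) z) else 0)"

lemma root_mult_pos_iff:
  assumes "nonconst_meromorphic f"
  shows "root_mult f z > 0 \<longleftrightarrow> \<not> is_pole f z \<and> f z \<in> S"
  using local_at_root(1)[OF assms, of z] by (auto simp: root_mult_def)

lemma poly_analytic:
  assumes "f analytic_on X"
  shows "(\<lambda>w. poly p (f w)) analytic_on X"
  unfolding poly_altdef by (intro analytic_intros assms)

lemma A_analytic:
  assumes "regular f z"
  shows "A f analytic_on {z}" "A f z \<noteq> 0"
  using assms unfolding regular_def A_def
  by (auto intro!: analytic_intros poly_analytic simp: poly_P_eq_0_iff Z_def)

lemma \<eta>_analytic:
  assumes "regular f z"
  shows "\<eta> f analytic_on {z}"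
  unfolding \<eta>_def using A_analytic[OF assms] by (intro analytic_intros) auto

lemma eventually_regular:
  assumes "regular f z"
  shows "\<forall>\<^sub>F w in nhds z. regular f w"
proof -
  have f: "f analytic_on {z}" "deriv f z \<noteq> 0" "f z \<notin> S" "f z \<notin> Z"
    using assms by (auto simp: regular_def)
  have "\<forall>\<^sub>F w in nhds z. f analytic_on {w}"
    using f(1) by (rule eventually_analytic_nhds)
  moreover have "\<forall>\<^sub>F w in nhds z. deriv f analytic_on {w} \<and> deriv f w \<noteq> 0"
    by (intro eventually_analytic_nonzero analytic_deriv f)
  moreover have "\<forall>\<^sub>F w in nhds z. (\<lambda>w. poly P (f w)) analytic_on {w} \<and> poly P (f w) \<noteq> 0"
    using f by (intro eventually_analytic_nonzero poly_analytic) (auto simp: poly_P_eq_0_iff)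
  moreover have "\<forall>\<^sub>F w in nhds z. (\<lambda>w. poly (pderiv P) (f w)) analytic_on {w} \<and> poly (pderiv P) (f w) \<noteq> 0"
    using f by (intro eventually_analytic_nonzero poly_analytic) (auto simp: Z_def)
  ultimately show ?thesis
    by eventually_elim (auto simp: regular_def poly_P_eq_0_iff Z_def)
qed

lemma N_continuous:
  assumes "regular f z"
  shows "isCont (N f) z"
proof -
  have f: "f analytic_on {z}" "deriv f z \<noteq> 0" "f z \<notin> S" "f z \<notin> Z"
    using assms by (auto simp: regular_def)
  have "isCont f z" "isCont (deriv f) z"
    using f(1) analytic_deriv analytic_at_imp_isCont by blast+
  moreover have "B (f z) \<noteq> 0" using f(4) finite_Z by (auto simp: B_def)
  ultimately show ?thesis
    unfolding N_def weight_def B_def cpow_def poly_P using f c_nonzero finite_S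
    by (intro continuous_intros) auto
qed

lemma T_continuous:
  assumes "regular f z" "regular g z"
  shows "isCont (T f g) z"
proof -
  define V where "V = (\<lambda>w. A f w / A g w)"
  have "isCont V z"
    unfolding V_def by (intro isCont_divide analytic_at_imp_isCont A_analytic assms)
  moreover have "V z \<noteq> 0"
    using A_analytic[OF assms(1)] A_analytic[OF assms(2)] by (simp add: V_def)
  ultimately have "isCont (\<lambda>w. cpow \<epsilon> (V w)) z"
    unfolding cpow_def by (intro continuous_intros) auto
  thus ?thesis
    unfolding T_def V_def
    by (intro continuous_intros N_continuous assms analytic_at_imp_isCont \<eta>_analytic)
qed

section \<open>Decay of the metric at exceptional points\<close>

lemma T_bigo:
  assumes "N f \<in> O[at z](\<lambda>w. norm (w - z) powr e)" "N g \<in> O[at z](\<lambda>w. norm (w - z) powr e')"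
    and "has_ord (A f) z v" "has_ord (A g) z v'"
    and "(\<lambda>w. norm (\<eta> f w - \<eta> g w)) \<in> O[at z](\<lambda>w. norm (w - z) powr h)"
  shows "T f g \<in> O[at z](\<lambda>w. norm (w - z) powr (e + e' + ((h + h) + (- \<epsilon> * \<bar>of_int (v - v')\<bar>))))"
  unfolding T_def[abs_def] power2_eq_square
  by (intro norm_powr_bigo_mult assms has_ord_cpow_bigo has_ord_divide eps_bounds(1))

text \<open>Each logarithmic derivative has its order as residue, so the poles cancel exactly when
  the orders agree.\<close>

lemma logderiv_diff_bigo:
  assumes "has_ord (A f) z v" "has_ord (A g) z v'"
  shows "(\<lambda>w. norm (\<eta> f w - \<eta> g w)) \<in> O[at z](\<lambda>w. norm (w - z) powr (if v = v' then 0 else - 1))"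
proof -
  obtain \<rho> where \<rho>: "\<rho> analytic_on {z}" "\<forall>\<^sub>F w in at z. \<eta> f w = of_int v / (w - z) + \<rho> w"
    using has_ord_logderiv[OF assms(1)] unfolding \<eta>_def by blast
  obtain \<sigma> where \<sigma>: "\<sigma> analytic_on {z}" "\<forall>\<^sub>F w in at z. \<eta> g w = of_int v' / (w - z) + \<sigma> w"
    using has_ord_logderiv[OF assms(2)] unfolding \<eta>_def by blast
  show ?thesis
  proof (cases "v = v'")
    case True
    have ev: "\<forall>\<^sub>F w in at z. norm (\<rho> w - \<sigma> w) = norm (\<eta> f w - \<eta> g w)"
      using \<rho>(2) \<sigma>(2) by eventually_elim (simp add: True)
    have "(\<lambda>w. norm (\<rho> w - \<sigma> w)) \<in> O[at z](\<lambda>w. norm (w - z) powr 0)"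
      by (intro analytic_bigo(1) analytic_intros \<rho> \<sigma>)
    thus ?thesis unfolding landau_o.big.in_cong[OF ev] using True by (simp only: refl if_True)
  next
    case False
    define h where "h = (\<lambda>w. of_int (v - v') + (\<rho> w - \<sigma> w) * (w - z))"
    have "(\<lambda>w. norm (h w) * norm (w - z) powr (-1)) \<in> O[at z](\<lambda>w. norm (w - z) powr (0 + -1))"
      unfolding h_def
      by (intro norm_powr_bigo_mult analytic_bigo(1) analytic_intros \<rho> \<sigma> landau_o.big_refl)
    moreover have ev: "\<forall>\<^sub>F w in at z. norm (h w) * norm (w - z) powr (-1) = norm (\<eta> f w - \<eta> g w)"
      using \<rho>(2) \<sigma>(2) eventually_at_neq
    proof eventually_elim
      case (elim w)
      have *: "(a / x + r) - (b / x + s) = ((a - b) + (r - s) * x) / x" if "x \<noteq> 0" for a b r s x :: complex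
        using that by (simp add: field_simps)
      have "\<eta> f w - \<eta> g w = h w / (w - z)"
        unfolding elim h_def of_int_diff by (rule *) (use elim(3) in simp)
      thus ?case using elim(3) by (simp add: norm_divide powr_minus_divide)
    qed
    ultimately show ?thesis unfolding landau_o.big.in_cong[OF ev] using False by (simp only: if_False add_0)
  qed
qed

text \<open>Both residues are -2 and both remainders vanish at \<open>z\<close>. The exponent 1
  gained here, doubled by squaring, offsets the exponents of \<open>N f\<close> and
  \<open>N g\<close>, each about -1 at a simple root.\<close>

lemma logderiv_diff_bigo_simple:
  assumes "nonconst_meromorphic f" "\<not> is_pole f z" "f z \<in> S" "zorder (\<lambda>w. f w - f z) z = 1"
    and "nonconst_meromorphic g" "\<not> is_pole g z" "g z \<in> S" "zorder (\<lambda>w. g w - g z) z = 1"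
  shows "(\<lambda>w. norm (\<eta> f w - \<eta> g w)) \<in> O[at z](\<lambda>w. norm (w - z) powr 1)"
proof -
  obtain \<rho> where \<rho>: "\<rho> analytic_on {z}" "\<rho> z = 0" "\<forall>\<^sub>F w in at z. \<eta> f w = - 2 / (w - z) + \<rho> w"
    using logderiv_simple_root[OF assms(1-4)] unfolding \<eta>_def by blast
  obtain \<sigma> where \<sigma>: "\<sigma> analytic_on {z}" "\<sigma> z = 0" "\<forall>\<^sub>F w in at z. \<eta> g w = - 2 / (w - z) + \<sigma> w"
    using logderiv_simple_root[OF assms(5-8)] unfolding \<eta>_def by blast
  have ev: "\<forall>\<^sub>F w in at z. norm (\<rho> w - \<sigma> w) = norm (\<eta> f w - \<eta> g w)"
    using \<rho>(3) \<sigma>(3) by eventually_elim simp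
  have "(\<lambda>w. norm (\<rho> w - \<sigma> w)) \<in> O[at z](\<lambda>w. norm (w - z) powr 1)"
    by (intro analytic_bigo(2) analytic_intros \<rho> \<sigma>) (simp add: \<rho> \<sigma>)
  thus ?thesis unfolding landau_o.big.in_cong[OF ev] .
qed

text \<open>Equality up to \<open>min 3\<close> leaves three cases: both multiplicities 1, both 2,
  or both at least 3. In the limit the exponents of \<open>T\<close> are \<open>- 1 - 1 + 2\<close>,
  \<open>0 + 0 + 0\<close> and at least \<open>1 + 1 - 2\<close>. Decay comes from what the
  perturbation leaves: \<open>2 \<epsilon>\<close>, \<open>8 \<epsilon>\<close> and at least
  \<open>8 \<epsilon>\<close>.\<close>

lemma T_tendsto_0_at_roots:
  assumes "nonconst_meromorphic f" "nonconst_meromorphic g"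
    and "min 3 (root_mult f z) = min 3 (root_mult g z)" "root_mult f z > 0" "root_mult g z > 0"
  shows "(T f g \<longlongrightarrow> 0) (at z)"
proof -
  define m where "m = zorder (\<lambda>w. f w - f z) z"
  define m' where "m' = zorder (\<lambda>w. g w - g z) z"
  have f: "\<not> is_pole f z" "f z \<in> S" and g: "\<not> is_pole g z" "g z \<in> S"
    using root_mult_pos_iff assms by blast+
  note F = local_at_root[OF assms(1) f, folded m_def]
  note G = local_at_root[OF assms(2) g, folded m'_def]
  have eq: "min 3 (nat m) = min 3 (nat m')" using assms(3) f g by (simp add: root_mult_def m_def m'_def)
  have main: "(T f g \<longlongrightarrow> 0) (at z)"
    if "(\<lambda>w. norm (\<eta> f w - \<eta> g w)) \<in> O[at z](\<lambda>w. norm (w - z) powr h)"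
       "expD * (of_int m - 1) - (expP + \<epsilon>) * of_int m + (expD * (of_int m' - 1) - (expP + \<epsilon>) * of_int m')
          + ((h + h) + (- \<epsilon> * \<bar>of_int (- m - 1 - (- m' - 1))\<bar>)) > 0" for h
    using norm_powr_bigo_tendsto_0[OF T_bigo[OF F(3) G(3) F(2) G(2) that(1)] that(2)] .
  consider "m = 1" "m' = 1" | "m = 2" "m' = 2" | "m \<ge> 3" "m' \<ge> 3"
    using eq F(1) G(1) by linarith
  thus ?thesis
  proof cases
    case 1
    show ?thesis
      by (rule main[OF logderiv_diff_bigo_simple])
         (use assms f g 1 eps_bounds(1) in \<open>auto simp: m_def m'_def expP_def\<close>)
  next
    case 2
    show ?thesis
      by (rule main[OF logderiv_diff_bigo[OF F(2) G(2)]])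
         (use 2 eps_bounds(1) in \<open>auto simp: expP_def expD_def\<close>)
  next
    case 3
    define x y where "x = real_of_int m" and "y = real_of_int m'"
    have xy: "x \<ge> 3" "y \<ge> 3" using 3 by (auto simp: x_def y_def)
    define h where "h = (if - m - 1 = - m' - 1 then 0 else - 1 :: real)"
    have h: "h \<ge> - 1" by (simp add: h_def)
    have "\<bar>real_of_int (- m - 1 - (- m' - 1))\<bar> \<le> x + y" using xy by (simp add: x_def y_def)
    hence "\<epsilon> * \<bar>real_of_int (- m - 1 - (- m' - 1))\<bar> \<le> \<epsilon> * (x + y)"
      using eps_bounds(1) by (intro mult_left_mono) auto
    \<comment> \<open>Expanded about the worst case \<open>x = y = 3\<close>; the constant 2 is what
      a simple pole of \<open>H\<close> uses up.\<close>
    moreover have "expD * (x - 1) - (expP + \<epsilon>) * x + (expD * (y - 1) - (expP + \<epsilon>) * y) - \<epsilon> * (x + y)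
         = 2 + 8 * \<epsilon> + (1 + 2 * \<epsilon>) * (x + y - 6)"
      unfolding expD_def expP_def by (simp add: algebra_simps)
    moreover have "0 \<le> (1 + 2 * \<epsilon>) * (x + y - 6)"
      using xy eps_bounds(1) by (intro mult_nonneg_nonneg) auto
    ultimately show ?thesis
      using h eps_bounds(1)
      by (intro main[OF logderiv_diff_bigo[OF F(2) G(2)], folded h_def x_def y_def]) linarith
  qed
qed

text \<open>One of the two functions is irregular at \<open>z\<close> and contributes more than 2,
  the other contributes at least 0, and \<open>H\<close> costs at most 2. The cost of
  \<open>cpow\<close> is split between them by the triangle inequality.\<close>

lemma T_tendsto_0_off_roots:
  assumes "nonconst_meromorphic f" "nonconst_meromorphic g"
    and "is_pole f z \<or> f z \<notin> S" "is_pole g z \<or> g z \<notin> S"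
    and "is_pole f z \<or> is_pole g z \<Longrightarrow> n \<ge> 2 * k + 7"
    and "\<not> (regular f z \<and> regular g z)"
  shows "(T f g \<longlongrightarrow> 0) (at z)"
proof -
  obtain e v where F: "N f \<in> O[at z](\<lambda>w. norm (w - z) powr e)" "has_ord (A f) z v"
    "(regular f z \<and> e = 0 \<and> v = 0) \<or> e - \<epsilon> * \<bar>of_int v\<bar> > 2"
    using local_off_roots[OF assms(1,3)] assms(5) by blast
  obtain e' v' where G: "N g \<in> O[at z](\<lambda>w. norm (w - z) powr e')" "has_ord (A g) z v'"
    "(regular g z \<and> e' = 0 \<and> v' = 0) \<or> e' - \<epsilon> * \<bar>of_int v'\<bar> > 2"
    using local_off_roots[OF assms(2,4)] assms(5) by blast
  define h where "h = (if v = v' then 0 else - 1 :: real)"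
  have "e - \<epsilon> * \<bar>of_int v\<bar> \<ge> 0" "e' - \<epsilon> * \<bar>of_int v'\<bar> \<ge> 0" using F(3) G(3) by auto
  moreover have "e - \<epsilon> * \<bar>of_int v\<bar> > 2 \<or> e' - \<epsilon> * \<bar>of_int v'\<bar> > 2" using F(3) G(3) assms(6) by blast
  ultimately have "e - \<epsilon> * \<bar>of_int v\<bar> + (e' - \<epsilon> * \<bar>of_int v'\<bar>) > 2" by linarith
  moreover have "\<epsilon> * \<bar>of_int (v - v')\<bar> \<le> \<epsilon> * (\<bar>of_int v\<bar> + \<bar>of_int v'\<bar>)"
    using eps_bounds(1) by (intro mult_left_mono) auto
  hence "\<epsilon> * \<bar>of_int (v - v')\<bar> \<le> \<epsilon> * \<bar>of_int v\<bar> + \<epsilon> * \<bar>of_int v'\<bar>"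
    by (simp only: distrib_left)
  moreover have "h \<ge> - 1" by (simp add: h_def)
  ultimately have "e + e' + ((h + h) + (- \<epsilon> * \<bar>of_int (v - v')\<bar>)) > 0"
    by linarith
  from norm_powr_bigo_tendsto_0[OF T_bigo[OF F(1) G(1) F(2) G(2)
      logderiv_diff_bigo[OF F(2) G(2), folded h_def]] this]
  show ?thesis .
qed

lemma U_continuous:
  assumes "nonconst_meromorphic f" "nonconst_meromorphic g"
    and "\<And>z. min 3 (root_mult f z) = min 3 (root_mult g z)"
    and "\<And>z. is_pole f z \<or> is_pole g z \<Longrightarrow> n \<ge> 2 * k + 7"
  shows "continuous_on UNIV (U f g)"
proof (rule continuous_at_imp_continuous_on, rule ballI)
  fix z
  show "isCont (U f g) z"
  proof (cases "regular f z \<and> regular g z")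
    case True
    hence "\<forall>\<^sub>F w in nhds z. regular f w" "\<forall>\<^sub>F w in nhds z. regular g w"
      using eventually_regular by blast+
    hence "\<forall>\<^sub>F w in nhds z. U f g w = T f g w"
      by eventually_elim (simp add: U_def)
    thus ?thesis using T_continuous True isCont_cong by blast
  next
    case False
    have "(T f g \<longlongrightarrow> 0) (at z)"
    proof (cases "root_mult f z = 0")
      case True
      hence "root_mult g z = 0" using assms(3)[of z] by (simp add: min_def split: if_splits)
      thus ?thesis
        using True False assms root_mult_pos_iff[OF assms(1), of z] root_mult_pos_iff[OF assms(2), of z]
        by (intro T_tendsto_0_off_roots) auto
    next
      case False
      hence "root_mult g z \<noteq> 0" using assms(3)[of z] by (simp add: min_def split: if_splits)
      thus ?thesis using False assms by (intro T_tendsto_0_at_roots) auto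
    qed
    moreover have "norm (U f g w) \<le> norm (T f g w)" for w by (simp add: U_def)
    ultimately have "(U f g \<longlongrightarrow> 0) (at z)"
      using Lim_null_comparison[of "U f g" "\<lambda>w. norm (T f g w)"] by (simp add: tendsto_rabs_zero)
    thus ?thesis using False by (auto simp: isCont_def U_def)
  qed
qed

text \<open>All factors except the \<open>cpow\<close> ones are powers of moduli of analytic
  functions without zeros near \<open>z\<close>, so only \<open>density\<close> survives.\<close>

lemma has_laplacian_ln_N:
  assumes "regular f z"
  shows "has_laplacian (\<lambda>w. ln (N f w)) z (4 * \<epsilon>\<^sup>2 * ((norm (deriv f z))\<^sup>2 * density (f z)))"
proof -
  have f: "f analytic_on {z}" "deriv f z \<noteq> 0" "f z \<notin> S" "f z \<notin> Z"
    using assms by (auto simp: regular_def)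
  have Bz: "B (f z) \<noteq> 0" using f(4) finite_Z by (auto simp: B_def)
  have Ba: "(\<lambda>w. B (f w)) analytic_on {z}" unfolding B_def by (intro analytic_intros f)
  have "has_laplacian (\<lambda>w. expD * ln (norm (deriv f w)) + (expB * ln (norm (B (f w)))
      + (- expP) * ln (norm (poly P (f w))) + (\<Sum>s\<in>S. ln (cpow \<epsilon> (f w - s))))) z
     (expD * 0 + (expB * 0 + (- expP) * 0 +
       (\<Sum>s\<in>S. 4 * \<epsilon>\<^sup>2 * (norm (deriv (\<lambda>w. f w - s) z / (f z - s)) / cpow \<epsilon> (f z - s))\<^sup>2)))"
    using f Bz
    by (intro has_laplacian_add has_laplacian_cmult has_laplacian_sum has_laplacian_ln_norm
          has_laplacian_ln_cpow finite_S poly_analytic Ba)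
       (auto intro!: analytic_intros simp: poly_P_eq_0_iff)
  moreover have "\<forall>\<^sub>F w in nhds z. expD * ln (norm (deriv f w)) + (expB * ln (norm (B (f w)))
      + (- expP) * ln (norm (poly P (f w))) + (\<Sum>s\<in>S. ln (cpow \<epsilon> (f w - s)))) = ln (N f w)"
    using eventually_regular[OF assms]
  proof eventually_elim
    case (elim w)
    have w: "f w \<notin> S" "f w \<notin> Z" "deriv f w \<noteq> 0" using elim by (auto simp: regular_def)
    have Bw: "B (f w) \<noteq> 0" using w finite_Z by (auto simp: B_def)
    have Cw: "cpow \<epsilon> (f w - s) > 0" if "s \<in> S" for s using w that by (intro cpow_pos) auto
    have "(\<Prod>s\<in>S. cpow \<epsilon> (f w - s)) > 0" by (intro prod_pos Cw)
    moreover have "ln (\<Prod>s\<in>S. cpow \<epsilon> (f w - s)) = (\<Sum>s\<in>S. ln (cpow \<epsilon> (f w - s)))"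
      using Cw by (intro ln_prod finite_S) force
    ultimately show ?case
      unfolding N_def weight_def using w Bw by (simp add: ln_mult poly_P_eq_0_iff)
  qed
  ultimately have "has_laplacian (\<lambda>w. ln (N f w)) z (expD * 0 + (expB * 0 + (- expP) * 0 +
       (\<Sum>s\<in>S. 4 * \<epsilon>\<^sup>2 * (norm (deriv (\<lambda>w. f w - s) z / (f z - s)) / cpow \<epsilon> (f z - s))\<^sup>2)))"
    by (rule has_laplacian_cong)
  also have "(\<Sum>s\<in>S. 4 * \<epsilon>\<^sup>2 * (norm (deriv (\<lambda>w. f w - s) z / (f z - s)) / cpow \<epsilon> (f z - s))\<^sup>2)
     = 4 * \<epsilon>\<^sup>2 * ((norm (deriv f z))\<^sup>2 * density (f z))"
    unfolding density_def sum_distrib_left deriv_diff_const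
    by (intro sum.cong) (auto simp: norm_divide power_divide power_mult_distrib)
  finally show ?thesis by simp
qed

lemma N_pos: "regular f z \<Longrightarrow> N f z > 0"
  unfolding N_def regular_def by (auto intro!: mult_pos_pos weight_pos)

text \<open>Up to the factor \<open>4 \<epsilon>\<^sup>2\<close>, the Laplacian of \<open>ln U\<close> at points where \<open>U\<close> is positive.\<close>

definition curv :: "(complex \<Rightarrow> complex) \<Rightarrow> (complex \<Rightarrow> complex) \<Rightarrow> complex \<Rightarrow> real" where
  "curv f g z = (norm (deriv f z))\<^sup>2 * density (f z) + (norm (deriv g z))\<^sup>2 * density (g z)
     + (norm (\<eta> f z - \<eta> g z) / cpow \<epsilon> (A f z / A g z))\<^sup>2"

text \<open>\<open>ln |H|\<close> is harmonic, but \<open>H\<close> is the logarithmic derivative of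
  \<open>A f / A g\<close>, so \<open>cpow\<close> of this quotient contributes a multiple of
  \<open>|H|^2\<close>. Thus \<open>H\<close> occurs both in the metric and in its curvature, as a
  comparison of the two requires.\<close>

lemma has_laplacian_ln_U:
  assumes "regular f z" "regular g z" "\<eta> f z \<noteq> \<eta> g z"
  shows "has_laplacian (\<lambda>w. ln (U f g w)) z (4 * \<epsilon>\<^sup>2 * curv f g z)"
proof -
  define V where "V = (\<lambda>w. A f w / A g w)"
  have V: "V analytic_on {z}" "V z \<noteq> 0"
    unfolding V_def using A_analytic[OF assms(1)] A_analytic[OF assms(2)] by (auto intro!: analytic_intros)
  have H: "(\<lambda>w. \<eta> f w - \<eta> g w) analytic_on {z}"
    by (intro analytic_intros \<eta>_analytic assms)
  have H': "\<eta> f z - \<eta> g z \<noteq> 0" using assms(3) by simp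
  have "has_laplacian (\<lambda>w. ln (N f w) + ln (N g w) + (2 * ln (norm (\<eta> f w - \<eta> g w)) + ln (cpow \<epsilon> (V w)))) z
     (4 * \<epsilon>\<^sup>2 * ((norm (deriv f z))\<^sup>2 * density (f z)) + 4 * \<epsilon>\<^sup>2 * ((norm (deriv g z))\<^sup>2 * density (g z))
       + (2 * 0 + 4 * \<epsilon>\<^sup>2 * (norm (deriv V z / V z) / cpow \<epsilon> (V z))\<^sup>2))"
    using assms V H
    by (intro has_laplacian_add has_laplacian_cmult has_laplacian_ln_N has_laplacian_ln_norm has_laplacian_ln_cpow) auto
  moreover have "deriv V z / V z = \<eta> f z - \<eta> g z"
  proof -
    have "(A f has_field_derivative deriv (A f) z) (at z)" "(A g has_field_derivative deriv (A g) z) (at z)"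
      by (intro analytic_derivI A_analytic assms)+
    hence "(V has_field_derivative (deriv (A f) z * A g z - A f z * deriv (A g) z) / (A g z * A g z)) (at z)"
      unfolding V_def using A_analytic(2)[OF assms(2)] by (intro DERIV_divide)
    hence "deriv V z = (deriv (A f) z * A g z - A f z * deriv (A g) z) / (A g z * A g z)"
      by (rule DERIV_imp_deriv)
    thus ?thesis using A_analytic(2)[OF assms(1)] A_analytic(2)[OF assms(2)]
      by (simp add: V_def \<eta>_def field_simps)
  qed
  moreover have "\<forall>\<^sub>F w in nhds z. ln (N f w) + ln (N g w) + (2 * ln (norm (\<eta> f w - \<eta> g w)) + ln (cpow \<epsilon> (V w)))
      = ln (U f g w)"
    using eventually_regular[OF assms(1)] eventually_regular[OF assms(2)]
      eventually_analytic_nonzero[OF V] eventually_analytic_nonzero[OF H H']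
  proof eventually_elim
    case (elim w)
    hence "N f w > 0" "N g w > 0" "cpow \<epsilon> (V w) > 0" "\<eta> f w \<noteq> \<eta> g w"
      using assms by (auto intro: N_pos cpow_pos)
    moreover have "U f g w = N f w * N g w * ((norm (\<eta> f w - \<eta> g w))\<^sup>2 * cpow \<epsilon> (V w))"
      using elim by (simp add: U_def T_def V_def)
    ultimately show ?case by (simp add: ln_mult ln_realpow)
  qed
  ultimately show ?thesis
    using has_laplacian_cong[of _ z _ "\<lambda>w. ln (U f g w)"]
    by (simp add: curv_def distrib_left V_def)
qed

section \<open>Comparison of the metric with its curvature\<close>

lemma N_A_le:
  obtains K where "K > 0" "\<And>f z \<tau>. regular f z \<Longrightarrow> \<bar>\<tau>\<bar> \<le> 3 * \<epsilon> \<Longrightarrow>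
    N f z * norm (A f z) powr \<tau> \<le> K * ((norm (deriv f z))\<^sup>2 * density (f z)) powr ((expD + \<tau>) / 2)"
proof -
  obtain K where K: "K > 0" "\<And>w \<tau>. w \<notin> S \<Longrightarrow> w \<notin> Z \<Longrightarrow> \<bar>\<tau>\<bar> \<le> 3 * \<epsilon> \<Longrightarrow>
    weight w * (norm (poly (pderiv P) w) / (norm (poly P w))\<^sup>2) powr \<tau> \<le> K * density w powr ((expD + \<tau>) / 2)"
    using weight_le_density by blast
  show ?thesis
  proof (rule that[OF K(1)])
    fix f z \<tau> assume "regular f z" and \<tau>: "\<bar>\<tau>\<bar> \<le> 3 * \<epsilon>"
    hence f: "deriv f z \<noteq> 0" "f z \<notin> S" "f z \<notin> Z" by (auto simp: regular_def)
    define d where "d = norm (deriv f z)"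
    have d: "d > 0" using f by (simp add: d_def)
    define q where "q = norm (poly (pderiv P) (f z)) / (norm (poly P (f z)))\<^sup>2"
    have "norm (A f z) = d * q"
      by (simp add: A_def d_def q_def norm_mult norm_divide norm_power)
    moreover have "N f z = d powr expD * weight (f z)" by (simp add: N_def d_def)
    moreover have "q \<ge> 0" by (simp add: q_def)
    ultimately have "N f z * norm (A f z) powr \<tau> = d powr (expD + \<tau>) * (weight (f z) * q powr \<tau>)"
      using d by (simp add: powr_mult powr_add)
    also have "\<dots> \<le> d powr (expD + \<tau>) * (K * density (f z) powr ((expD + \<tau>) / 2))"
      unfolding q_def by (rule mult_left_mono[OF K(2)[OF f(2,3) \<tau>]]) simp
    also have "\<dots> = K * (d\<^sup>2 * density (f z)) powr ((expD + \<tau>) / 2)"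
      using d density_pos[OF f(2)] by (simp add: powr_mult powr_powr add_divide_distrib flip: powr_numeral)
    finally show "N f z * norm (A f z) powr \<tau> \<le> K * ((norm (deriv f z))\<^sup>2 * density (f z)) powr ((expD + \<tau>) / 2)"
      by (simp add: d_def)
  qed
qed

text \<open>The sum of \<open>x\<close> and its inverse is at most twice the larger one, whose cube
  is one of the two powers on the right. At \<open>w = 0\<close> all powers are 0 by
  convention.\<close>

lemma cpow_le: "cpow \<epsilon> w ^ 3 \<le> 8 * (norm w powr (3 * \<epsilon>) + norm w powr (- (3 * \<epsilon>)))"
proof (cases "w = 0")
  case False
  define x where "x = norm w powr \<epsilon>"
  have x: "x > 0" using False by (simp add: x_def)
  have c: "cpow \<epsilon> w = x + inverse x" by (simp add: cpow_def x_def powr_minus)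
  have le: "cpow \<epsilon> w \<le> 2 * max x (inverse x)" unfolding c by linarith
  have "cpow \<epsilon> w ^ 3 \<le> (2 * max x (inverse x)) ^ 3"
    by (rule power_mono[OF le]) (use x in \<open>simp add: c\<close>)
  also have "\<dots> = 8 * max x (inverse x) ^ 3" by (simp add: power_mult_distrib)
  also have "max x (inverse x) ^ 3 \<le> x ^ 3 + inverse x ^ 3" using x by (simp add: max_def)
  also have "x ^ 3 = norm w powr (3 * \<epsilon>)" using False by (simp add: x_def powr_powr mult.commute flip: powr_realpow)
  also have "inverse x ^ 3 = norm w powr (- (3 * \<epsilon>))"
    using False by (simp add: x_def powr_minus power_inverse powr_powr mult.commute flip: powr_realpow)
  finally show ?thesis by simp
qed (simp add: cpow_def)

text \<open>With \<open>C\<close> the \<open>cpow\<close> factor of \<open>U\<close>, the metric is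
  \<open>|H|^2 / C^2\<close>, a summand of \<open>curv\<close>, times
  \<open>N f * N g * C^3\<close>. The cube turns into powers \<open>3 \<epsilon>\<close> and
  \<open>- 3 \<epsilon>\<close> of \<open>|A f|\<close>, with opposite ones of \<open>|A g|\<close>;
  this fixes the range of \<open>\<tau>\<close>. The two contributions of \<open>\<tau>\<close> to
  the exponent cancel and leave \<open>expD\<close>, and the summand with \<open>H\<close> adds
  1.\<close>

lemma U_le_curv:
  obtains K where "K > 0" "\<And>f g z. regular f z \<Longrightarrow> regular g z \<Longrightarrow> U f g z \<le> K * curv f g z powr (expD + 1)"
proof -
  obtain K where K: "K > 0" "\<And>f z \<tau>. regular f z \<Longrightarrow> \<bar>\<tau>\<bar> \<le> 3 * \<epsilon> \<Longrightarrow>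
    N f z * norm (A f z) powr \<tau> \<le> K * ((norm (deriv f z))\<^sup>2 * density (f z)) powr ((expD + \<tau>) / 2)"
    using N_A_le by blast
  show ?thesis
  proof (rule that[of "16 * K\<^sup>2"])
    show "16 * K\<^sup>2 > 0" using K by simp
    fix f g z assume reg: "regular f z" "regular g z"
    define L where "L = curv f g z"
    define C where "C = cpow \<epsilon> (A f z / A g z)"
    have nz: "A f z \<noteq> 0" "A g z \<noteq> 0" using A_analytic reg by auto
    have C: "C > 0" unfolding C_def using nz by (intro cpow_pos) auto
    have dens: "density (f z) > 0" "density (g z) > 0"
      using reg by (auto simp: regular_def intro: density_pos)
    have nonneg: "0 \<le> (norm (deriv f z))\<^sup>2 * density (f z)" "0 \<le> (norm (deriv g z))\<^sup>2 * density (g z)"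
      using dens by (auto intro!: mult_nonneg_nonneg)
    have L: "(norm (deriv f z))\<^sup>2 * density (f z) \<le> L" "(norm (deriv g z))\<^sup>2 * density (g z) \<le> L"
      "(norm (\<eta> f z - \<eta> g z) / C)\<^sup>2 \<le> L" "0 \<le> L"
      using nonneg unfolding L_def curv_def C_def by auto
    have eD: "expD - 3 * \<epsilon> \<ge> 0" "expD + 3 * \<epsilon> \<ge> 0" using eps_bounds unfolding expD_def by auto
    have bound: "N f z * N g z * (norm (A f z) powr \<tau> * norm (A g z) powr (- \<tau>)) \<le> K\<^sup>2 * L powr expD"
      if "\<bar>\<tau>\<bar> = 3 * \<epsilon>" for \<tau>
    proof -
      have \<tau>: "expD + \<tau> \<ge> 0" "expD - \<tau> \<ge> 0" using that eD by (auto simp: abs_real_def split: if_splits)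
      have "N f z * norm (A f z) powr \<tau> \<le> K * L powr ((expD + \<tau>) / 2)"
        using K(2)[OF reg(1), of \<tau>] that powr_mono2[OF _ nonneg(1) L(1), of "(expD + \<tau>) / 2"] \<tau> K(1)
        by (smt (verit) mult_left_mono divide_nonneg_nonneg)
      moreover have "N g z * norm (A g z) powr (- \<tau>) \<le> K * L powr ((expD - \<tau>) / 2)"
        using K(2)[OF reg(2), of "- \<tau>"] that powr_mono2[OF _ nonneg(2) L(2), of "(expD - \<tau>) / 2"] \<tau> K(1)
        by (smt (verit) mult_left_mono divide_nonneg_nonneg)
      ultimately have "(N f z * norm (A f z) powr \<tau>) * (N g z * norm (A g z) powr (- \<tau>))
          \<le> (K * L powr ((expD + \<tau>) / 2)) * (K * L powr ((expD - \<tau>) / 2))"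
        by (rule mult_mono) (use N_pos[OF reg(1)] N_pos[OF reg(2)] K(1) in auto)
      also have "\<dots> = K\<^sup>2 * L powr ((expD + \<tau>) / 2 + (expD - \<tau>) / 2)"
        by (simp only: powr_add power2_eq_square mult_ac)
      also have "(expD + \<tau>) / 2 + (expD - \<tau>) / 2 = expD" by (simp add: field_simps)
      finally show ?thesis by (simp add: mult_ac)
    qed
    have quot: "norm (A f z / A g z) powr \<tau> = norm (A f z) powr \<tau> * norm (A g z) powr (- \<tau>)" for \<tau>
      using nz by (simp add: norm_divide powr_divide powr_minus_divide)
    have NN: "N f z * N g z > 0" using N_pos reg by simp
    have "N f z * N g z * C ^ 3 \<le> N f z * N g z *
        (8 * (norm (A f z / A g z) powr (3 * \<epsilon>) + norm (A f z / A g z) powr (- (3 * \<epsilon>))))"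
      unfolding C_def using NN by (intro mult_left_mono cpow_le) auto
    also have "\<dots> = 8 * (N f z * N g z * (norm (A f z) powr (3 * \<epsilon>) * norm (A g z) powr (- (3 * \<epsilon>))))
        + 8 * (N f z * N g z * (norm (A f z) powr (- (3 * \<epsilon>)) * norm (A g z) powr (- (- (3 * \<epsilon>)))))"
      unfolding quot by (simp only: distrib_left mult_ac)
    also have "\<dots> \<le> 8 * (K\<^sup>2 * L powr expD) + 8 * (K\<^sup>2 * L powr expD)"
      by (intro add_mono mult_left_mono bound) (use eps_bounds(1) in auto)
    finally have cube: "N f z * N g z * C ^ 3 \<le> 16 * K\<^sup>2 * L powr expD" by (simp add: mult_ac)
    have "U f g z = (norm (\<eta> f z - \<eta> g z) / C)\<^sup>2 * (N f z * N g z * C ^ 3)"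
      using reg C by (simp add: U_def T_def C_def[symmetric] power_divide power2_eq_square power3_eq_cube)
    also have "\<dots> \<le> L * (16 * K\<^sup>2 * L powr expD)"
      by (rule mult_mono[OF L(3) cube L(4)]) (use NN C in auto)
    also have "\<dots> = 16 * K\<^sup>2 * L powr (expD + 1)"
      using L(4) by (simp add: powr_add)
    finally show "U f g z \<le> 16 * K\<^sup>2 * curv f g z powr (expD + 1)" by (simp add: L_def)
  qed
qed

lemma U_eq_0:
  assumes "nonconst_meromorphic f" "nonconst_meromorphic g"
    and "\<And>z. min 3 (root_mult f z) = min 3 (root_mult g z)"
    and "\<And>z. is_pole f z \<or> is_pole g z \<Longrightarrow> n \<ge> 2 * k + 7"
  shows "U f g z = 0"
proof -
  obtain K where K: "K > 0"
    "\<And>z. regular f z \<Longrightarrow> regular g z \<Longrightarrow> U f g z \<le> K * curv f g z powr (expD + 1)"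
    using U_le_curv by metis
  define K' where "K' = K / (4 * \<epsilon>\<^sup>2) powr (expD + 1)"
  show ?thesis
  proof (rule ahlfors_schwarz_vanish[of "U f g" "expD + 1" K'])
    show "continuous_on UNIV (U f g)" by (rule U_continuous) (use assms in auto)
    show "expD + 1 > 0" "K' > 0" using eps_bounds(1) K(1) by (auto simp: expD_def K'_def)
    fix z
    have "cpow \<epsilon> w \<ge> 0" for w by (simp add: cpow_def)
    thus "U f g z \<ge> 0" using N_pos by (auto simp: U_def T_def less_imp_le)
    assume "U f g z > 0"
    hence reg: "regular f z" "regular g z" and ne: "\<eta> f z \<noteq> \<eta> g z"
      by (auto simp: U_def T_def split: if_splits)
    have curv: "curv f g z \<ge> 0"
      unfolding curv_def using reg by (auto simp: regular_def intro!: add_nonneg_nonneg mult_nonneg_nonneg less_imp_le[OF density_pos])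
    have "U f g z \<le> K * curv f g z powr (expD + 1)" by (rule K(2)) fact+
    also have "\<dots> = K' * (4 * \<epsilon>\<^sup>2 * curv f g z) powr (expD + 1)"
      using curv eps_bounds(1) by (simp add: K'_def powr_mult)
    finally show "\<exists>L\<ge>0. has_laplacian (\<lambda>x. ln (U f g x)) z L \<and> U f g z \<le> K' * L powr (expD + 1)"
      using has_laplacian_ln_U[OF reg ne] curv by (intro exI[of _ "4 * \<epsilon>\<^sup>2 * curv f g z"]) auto
  qed
qed

text \<open>At the regular points around a common root all factors of \<open>U\<close> except
  \<open>|H|\<close> are positive, so \<open>U = 0\<close> gives \<open>H = 0\<close> there. This is
  incompatible with the residue \<open>m' - m\<close> that \<open>H\<close> has at the root.\<close>

lemma root_mult_eq:
  assumes "nonconst_meromorphic f" "nonconst_meromorphic g"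
    and "\<And>z. min 3 (root_mult f z) = min 3 (root_mult g z)"
    and "\<And>z. is_pole f z \<or> is_pole g z \<Longrightarrow> n \<ge> 2 * k + 7"
  shows "root_mult f z = root_mult g z"
proof (rule ccontr)
  assume ne: "root_mult f z \<noteq> root_mult g z"
  have "root_mult f z > 0" "root_mult g z > 0"
    using ne assms(3)[of z] by (auto simp: min_def split: if_splits)
  hence f: "\<not> is_pole f z" "f z \<in> S" and g: "\<not> is_pole g z" "g z \<in> S"
    using root_mult_pos_iff assms(1,2) by blast+
  define m where "m = zorder (\<lambda>w. f w - f z) z"
  define m' where "m' = zorder (\<lambda>w. g w - g z) z"
  note F = local_at_root[OF assms(1) f, folded m_def]
  note G = local_at_root[OF assms(2) g, folded m'_def]
  have "m \<noteq> m'" using ne f g by (auto simp: root_mult_def m_def m'_def)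
  \<comment> \<open>Finite orders keep \<open>P(h)\<close> and the derivative of \<open>h\<close>
    away from 0 on a punctured neighbourhood; \<open>P'(h)\<close> is nonzero already at
    \<open>z\<close>, the roots of \<open>P\<close> being simple.\<close>
  have reg: "\<forall>\<^sub>F w in at z. regular h w" if h: "nonconst_meromorphic h" "\<not> is_pole h z" "h z \<in> S" for h
  proof -
    from nonconst_meromorphic_local[OF h(1), of z] h(2) obtain r where 
      h': "h analytic_on {z}" "has_ord (deriv h) z r" by blast
    have "isCont h z" using h'(1) by (rule analytic_at_imp_isCont)
    have "\<forall>\<^sub>F w in nhds z. h analytic_on {w}" using h'(1) by (rule eventually_analytic_nhds)
    hence "\<forall>\<^sub>F w in at z. h analytic_on {w}" by (auto simp: eventually_at_filter elim: eventually_mono)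
    moreover have "\<forall>\<^sub>F w in at z. poly P (h w) \<noteq> 0"
      using has_ord_eventually[OF local_at_root(4)[OF h]] by eventually_elim auto
    moreover have "\<forall>\<^sub>F w in nhds z. poly (pderiv P) (h w) \<noteq> 0"
      using eventually_analytic_nonzero[OF poly_analytic[OF h'(1)], of "pderiv P"] rsquarefree_P[OF h(3)]
      by (auto simp: Z_def elim: eventually_mono)
    hence "\<forall>\<^sub>F w in at z. poly (pderiv P) (h w) \<noteq> 0" by (auto simp: eventually_at_filter elim: eventually_mono)
    ultimately show ?thesis
      using has_ord_eventually[OF h'(2)] by eventually_elim (auto simp: regular_def poly_P_eq_0_iff Z_def)
  qed
  obtain \<rho> where \<rho>: "\<rho> analytic_on {z}" "\<forall>\<^sub>F w in at z. \<eta> f w = of_int (- m - 1) / (w - z) + \<rho> w"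
    using has_ord_logderiv[OF F(2)] unfolding \<eta>_def by blast
  obtain \<sigma> where \<sigma>: "\<sigma> analytic_on {z}" "\<forall>\<^sub>F w in at z. \<eta> g w = of_int (- m' - 1) / (w - z) + \<sigma> w"
    using has_ord_logderiv[OF G(2)] unfolding \<eta>_def by blast
  \<comment> \<open>Equality of the two expansions, multiplied by \<open>w - z\<close>; the right
    side tends to 0 while the left side is constant.\<close>
  have "\<forall>\<^sub>F w in at z. of_int (m - m') = (\<rho> w - \<sigma> w) * (w - z)"
    using reg[OF assms(1) f] reg[OF assms(2) g] \<rho>(2) \<sigma>(2) eventually_at_neq
  proof eventually_elim
    case (elim w)
    have "N f w > 0" "N g w > 0" "cpow \<epsilon> (A f w / A g w) > 0"
      using elim A_analytic(2) by (auto intro!: N_pos cpow_pos)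
    moreover have "U f g w = 0" by (rule U_eq_0) (use assms in auto)
    ultimately have "\<eta> f w = \<eta> g w" using elim by (simp add: U_def T_def)
    thus ?case unfolding elim using elim(5) by (simp add: field_simps)
  qed
  moreover have "((\<lambda>w. (\<rho> w - \<sigma> w) * (w - z)) \<longlongrightarrow> (\<rho> z - \<sigma> z) * (z - z)) (at z)"
    using analytic_at_imp_isCont[OF \<rho>(1)] analytic_at_imp_isCont[OF \<sigma>(1)]
    by (intro tendsto_intros) (auto simp: isCont_def)
  ultimately have "((\<lambda>_. of_int (m - m') :: complex) \<longlongrightarrow> 0) (at z)"
    by (simp add: tendsto_cong)
  hence "of_int (m - m') = (0 :: complex)" using tendsto_unique[OF at_neq_bot tendsto_const] by metis
  thus False using \<open>m \<noteq> m'\<close> by simp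
qed

end

section \<open>Unique range sets\<close>

lemma infinfinfsum_eq_single:
  fixes F :: "'a \<Rightarrow> nat"
  assumes "finite S" "\<And>a. a \<noteq> b \<Longrightarrow> F a = 0"
  shows "(\<Sum>\<^sub>\<infinity>a\<in>S. F a) = (if b \<in> S then F b else 0)"
proof -
  have "(\<Sum>\<^sub>\<infinity>a\<in>S. F a) = (\<Sum>a\<in>S. F a)" using assms(1) by (rule infsum_finite)
  also have "\<dots> = (\<Sum>a\<in>S. if a = b then F b else 0)" by (intro sum.cong) (auto simp: assms(2))
  finally show ?thesis using assms(1) by simp
qed

lemma E_set_eq:
  assumes "finite S"
  shows "E_set f S z = (if f z \<in> S then point_mult f (f z) z else 0)"
  unfolding E_set_def using assms by (rule infinfinfsum_eq_single) (auto simp: point_mult_def)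

text \<open>At level 2 a multiplicity above 2 is counted as 3, which is \<open>min 3\<close>; this
  commutes with the sum because only \<open>a = f z\<close> can contribute.\<close>

lemma E_trunc_eq:
  assumes "finite S"
  shows "E_trunc f S 2 z = min 3 (E_set f S z)"
proof -
  have pt: "E_trunc_point 2 a f z = min 3 (point_mult f a z)" for a
    by (simp add: E_trunc_point_def numeral_eq_enat Let_def)
  show ?thesis
    unfolding E_trunc_def E_set_eq[OF assms] pt
    by (subst infinfinfsum_eq_single[OF assms, of "f z"]) (auto simp: point_mult_def)
qed

lemma E_trunc_cong:
  assumes "finite S" "E_set f S = E_set g S"
  shows "E_trunc f S 2 = E_trunc g S 2"
  using assms by (simp add: fun_eq_iff E_trunc_eq)

lemma (in simple_roots) E_set_eq_root_mult: "E_set f S z = root_mult f z"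
  by (simp add: E_set_eq[OF finite_S] root_mult_def point_mult_def)

lemma nonconst_entire_imp_meromorphic:
  assumes "nonconst_entire f"
  shows "nonconst_meromorphic f" "\<not> is_pole f z"
proof -
  have "f analytic_on UNIV" using assms by (simp add: nonconst_entire_def analytic_on_open)
  thus "nonconst_meromorphic f"
    using assms by (auto simp: nonconst_entire_def nonconst_meromorphic_def intro: analytic_on_imp_nicely_meromorphic_on)
  show "\<not> is_pole f z"
    using \<open>f analytic_on UNIV\<close> analytic_on_subset[of f UNIV "{z}"] analytic_at_imp_no_pole by blast
qed

theorem corollary2p1:
  fixes P :: "complex poly" and a\<^sub>0 :: complex and \<alpha> :: "nat \<Rightarrow> complex"
    and n k :: nat and S :: "complex set"
  assumes "a\<^sub>0 \<noteq> 0"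
    and "P = smult a\<^sub>0 (\<Prod>i=1..n. [:- \<alpha> i, 1:])"
    and "\<And>i j. i \<in> {1..n} \<Longrightarrow> j \<in> {1..n} \<Longrightarrow> i \<noteq> j \<Longrightarrow> \<alpha> i \<noteq> \<alpha> j"
    and "S = \<alpha> ` {1..n}"
    and "k = card {z. poly (pderiv P) z = 0}"
  shows "(n \<ge> 2 * k + 7 \<longrightarrow> (URSM_trunc 2 S \<longleftrightarrow> URSM S)) \<and>
         (n \<ge> 2 * k + 3 \<longrightarrow> (URSE_trunc 2 S \<longleftrightarrow> URSE S))"
proof -
  have inj: "inj_on \<alpha> {1..n}" using assms(3) by (force simp: inj_on_def)
  have fin: "finite S" and card: "card S = n"
    using inj by (simp_all add: assms(4) card_image)
  have P: "P = smult a\<^sub>0 (\<Prod>s\<in>S. [:- s, 1:])"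
    unfolding assms(2,4) using prod.reindex[OF inj, of "\<lambda>s. [:- s, 1:]"] by (simp add: o_def)
  \<comment> \<open>The bound with 7 is conditional on the presence of a pole. Entire functions have
    none, so both halves of the theorem can use this.\<close>
  have E_eq: "E_set f S = E_set g S"
    if "n \<ge> 2 * k + 3" "nonconst_meromorphic f" "nonconst_meromorphic g" "E_trunc f S 2 = E_trunc g S 2"
      and pole: "\<And>z. is_pole f z \<or> is_pole g z \<Longrightarrow> n \<ge> 2 * k + 7" for f g
  proof -
    interpret simple_roots P S a\<^sub>0
    proof
      show "card S \<ge> 2 * card {z. poly (pderiv P) z = 0} + 3"
        using that(1) unfolding card assms(5) .
    qed (fact fin assms(1) P)+
    have nk: "simple_roots.n S = n" "simple_roots.k P = k"
      by (simp_all only: n_def k_def Z_def card assms(5))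
    have "min 3 (root_mult f z) = min 3 (root_mult g z)" for z
      using fun_cong[OF that(4), of z] by (simp only: E_trunc_eq[OF fin] E_set_eq_root_mult)
    moreover have "simple_roots.n S \<ge> 2 * simple_roots.k P + 7" if "is_pole f z \<or> is_pole g z" for z
      using pole[OF that] by (simp only: nk)
    ultimately have eq: "root_mult f z = root_mult g z" for z
      by (rule root_mult_eq[OF that(2,3)])
    show ?thesis by (rule ext) (simp only: E_set_eq_root_mult eq)
  qed
  have "URSM_trunc 2 S \<longleftrightarrow> URSM S" if n: "n \<ge> 2 * k + 7"
  proof -
    \<comment> \<open>The two conditions agree for each pair \<open>f\<close>, \<open>g\<close>,
      which is more than equivalence of the two uniqueness properties.\<close>
    have "E_trunc f S 2 = E_trunc g S 2 \<longleftrightarrow> E_set f S = E_set g S"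
      if "nonconst_meromorphic f" "nonconst_meromorphic g" for f g
    proof
      assume "E_trunc f S 2 = E_trunc g S 2"
      thus "E_set f S = E_set g S" by (intro E_eq that) (use n in auto)
    qed (rule E_trunc_cong[OF fin])
    thus ?thesis by (simp add: URSM_trunc_def URSM_def cong: imp_cong)
  qed
  moreover have "URSE_trunc 2 S \<longleftrightarrow> URSE S" if n: "n \<ge> 2 * k + 3"
  proof -
    have "E_trunc f S 2 = E_trunc g S 2 \<longleftrightarrow> E_set f S = E_set g S"
      if "nonconst_entire f" "nonconst_entire g" for f g
    proof
      assume "E_trunc f S 2 = E_trunc g S 2"
      thus "E_set f S = E_set g S"
        by (intro E_eq n nonconst_entire_imp_meromorphic that)
           (use nonconst_entire_imp_meromorphic(2) that in auto)
    qed (rule E_trunc_cong[OF fin])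
    thus ?thesis by (simp add: URSE_trunc_def URSE_def cong: imp_cong)
  qed
  ultimately show ?thesis by blast
qed

end
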